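(* Let $\mathfrak{r}$ be a complex solvable rigid Lie algebra whose nilradical is nonsplit and of characteristic sequence $(3,1,\dots,1)$. Then a set of functionally independent invariants of the coadjoint representation of $\mathfrak{r}$ is given by the following functions, where lower-case letters denote the coordinates on $\mathfrak{r}^{*}$ corresponding to the basis elements denoted by the same upper-case letters: 1. $\left\{\dfrac{y_{2k-1}y_{2k}+x_{3}v_{k+2}}{x_{3}}\right\}_{1\le k\le m-2}$ if $\mathfrak{r}\simeq\mathfrak{d}_{2m}$; 2. $\left\{\dfrac{x_{0}x_{2}x_{3}+x_{2}^{2}y_{2m-3}-2x_{3}^{2}v_{2}+v_{1}x_{3}^{2}-2x_{1}x_{3}y_{2m-3}}{-2x_{3}^{2}},\ \dfrac{x_{3}v_{k+2}+y_{2k-1}y_{2k}}{x_{3}}\right\}_{1\le k\le m-2}$ if $\mathfrak{r}\simeq\mathfrak{d}_{2m+1}$; 3. $\left\{\dfrac{(2x_{0}y_{1}+x_{2}^{2}-2x_{1}x_{3})^{3}}{(x_{3}y_{1})^{2}}\right\}$ if $\mathfrak{r}\simeq\mathfrak{d}_{5}'$. Here $\mathfrak{d}_{2m}$ ($m\ge 3$), $\mathfrak{d}_{2m+1}$ ($m\ge 2$) and $\mathfrak{d}_5'$ are the Lie algebras, with distinguished bases, defined in the context.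
   Context: All Lie algebras are finite-dimensional over $\mathbb{C}$; brackets of basis elements that are not written are zero or obtained by antisymmetry. Rigid: the Lie algebra laws on $\mathbb{C}^n$ form an algebraic variety $\mathfrak{L}^n\subset\mathbb{C}^{n^3}$ (structure constants satisfying antisymmetry and the Jacobi identity), on which $GL(n,\mathbb{C})$ acts by change of basis; a law is rigid if its orbit is open in $\mathfrak{L}^n$. Nonsplit: not a direct sum of two nonzero ideals. Characteristic sequence of a nilpotent Lie algebra $\mathfrak{n}$: for $X\in\mathfrak{n}\setminus[\mathfrak{n},\mathfrak{n}]$ let $c(X)$ be the decreasing sequence of the sizes of the Jordan blocks of $\mathrm{ad}(X)$; the characteristic sequence is the maximum of the $c(X)$ in lexicographic order. Invariants: let $\mathfrak{g}$ have basis $Z_1,\dots,Z_n$ with $[Z_i,Z_j]=\sum_k C_{ij}^kZ_k$, and let $z_1,\dots,z_n$ be the corresponding linear coordinates on $\mathfrak{g}^*$. An invariant of the coadjoint representation (generalized Casimir invariant) is a differentiable function $F(z_1,\dots,z_n)$ (not necessarily polynomial; defined where it makes sense) with $\widehat{Z_i}F:=-\sum_{j,k}C_{ij}^kz_k\,\partial F/\partial z_j=0$ for all $1\le i\le n$. Invariants are functionally independent if their differentials are linearly independent at generic points. The algebra $\mathfrak{d}_{2m}$ ($m\ge 3$) has basis $X_0,\dots,X_3,Y_1,\dots,Y_{2m-4},V_1,\dots,V_m$ and brackets $[X_0,X_i]=X_{i+1}$ ($i=1,2$); $[Y_{2i-1},Y_{2i}]=X_3$ ($1\le i\le m-2$);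 $[V_1,X_i]=(i+1)X_i$ ($0\le i\le 3$); $[V_1,Y_{2i-1}]=(i+4)Y_{2i-1}$, $[V_1,Y_{2i}]=-iY_{2i}$ ($1\le i\le m-2$); $[V_2,X_i]=X_i$ ($i=1,2,3$); $[V_2,Y_{2i}]=Y_{2i}$ ($1\le i\le m-2$); $[V_{i+2},Y_{2i-1}]=Y_{2i-1}$, $[V_{i+2},Y_{2i}]=-Y_{2i}$ ($1\le i\le m-2$). The algebra $\mathfrak{d}_{2m+1}$ ($m\ge 2$) has basis $X_0,\dots,X_3,Y_1,\dots,Y_{2m-3},V_1,\dots,V_m$ and brackets $[X_0,X_i]=X_{i+1}$ ($i=1,2$); $[X_1,Y_{2m-3}]=X_3$; $[Y_{2i-1},Y_{2i}]=X_3$ ($1\le i\le m-2$); $[V_1,X_i]=(i+1)X_i$ ($0\le i\le 3$); $[V_1,Y_{2i-1}]=(i+4)Y_{2i-1}$, $[V_1,Y_{2i}]=-iY_{2i}$ ($1\le i\le m-2$); $[V_1,Y_{2m-3}]=2Y_{2m-3}$; $[V_2,X_i]=X_i$ ($i=1,2,3$); $[V_2,Y_{2i}]=Y_{2i}$ ($1\le i\le m-2$); $[V_{i+2},Y_{2i-1}]=Y_{2i-1}$, $[V_{i+2},Y_{2i}]=-Y_{2i}$ ($1\le i\le m-2$). The algebra $\mathfrak{d}_5'$ has basis $X_0,\dots,X_3,Y_1,V_1,V_2$ and brackets $[X_0,X_i]=X_{i+1}$ ($i=1,2$); $[X_1,X_2]=Y_1$; $[V_1,X_i]=(i+1)X_i$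 ($0\le i\le 3$), $[V_1,Y_1]=5Y_1$; $[V_2,X_i]=X_i$ ($i=1,2,3$), $[V_2,Y_1]=2Y_1$. (By a known classification, every $\mathfrak{r}$ as in the hypothesis is isomorphic to one of these algebras.)
   Formalization: In item 2 the printed first function is not an invariant (the operator of X_3 sends it to -x_3), so v_1 in it is replaced by v_1 - 2v_2 - sum_{k=1}^{m-2} (k+4) v_{k+2}. *)

theory Defs
  imports "HOL-Analysis.Analysis"
begin

section \<open>Lie algebra laws on complex n-space\<close>

text \<open>A law is its array of structure constants: \<open>c $ i $ j $ k\<close> is the coefficient of the k-th
  standard basis vector in the bracket of the i-th and the j-th one.\<close>

type_synonym 'n law = "complex^'n^'n^'n"

definition lie_laws :: "('n::finite) law set" where
  "lie_laws = {c. (\<forall>i j k. c $ i $ j $ k = - c $ j $ i $ k) \<and>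
     (\<forall>i j k s. (\<Sum>l\<in>UNIV. c $ i $ j $ l * c $ l $ k $ s + c $ j $ k $ l * c $ l $ i $ s
        + c $ k $ i $ l * c $ l $ j $ s) = 0)}"

definition bracket :: "('n::finite) law \<Rightarrow> complex^'n \<Rightarrow> complex^'n \<Rightarrow> complex^'n" where
  "bracket c x y = (\<chi> k. \<Sum>i\<in>UNIV. \<Sum>j\<in>UNIV. x $ i * y $ j * c $ i $ j $ k)"

definition change_basis :: "complex^'n^'n \<Rightarrow> ('n::finite) law \<Rightarrow> 'n law" where
  "change_basis g c = (\<chi> i j k.
     (g *v bracket c (matrix_inv g *v axis i 1) (matrix_inv g *v axis j 1)) $ k)"

definition rigid :: "('n::finite) law \<Rightarrow> bool" where
  "rigid c \<longleftrightarrow> openin (top_of_set lie_laws) {change_basis g c | g. invertible g}"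

definition lie_prod :: "('n::finite) law \<Rightarrow> (complex^'n) set \<Rightarrow> (complex^'n) set \<Rightarrow> (complex^'n) set" where
  "lie_prod c A B = vec.span {bracket c x y | x y. x \<in> A \<and> y \<in> B}"

fun derived_series :: "('n::finite) law \<Rightarrow> nat \<Rightarrow> (complex^'n) set" where
  "derived_series c 0 = UNIV"
| "derived_series c (Suc k) = lie_prod c (derived_series c k) (derived_series c k)"

definition solvable :: "('n::finite) law \<Rightarrow> bool" where
  "solvable c \<longleftrightarrow> (\<exists>k. derived_series c k = {0})"

fun lower_central_series :: "('n::finite) law \<Rightarrow> (complex^'n) set \<Rightarrow> nat \<Rightarrow> (complex^'n) set" where
  "lower_central_series c N 0 = N"
| "lower_central_series c N (Suc k) = lie_prod c N (lower_central_series c N k)"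

definition nilpotent :: "('n::finite) law \<Rightarrow> (complex^'n) set \<Rightarrow> bool" where
  "nilpotent c N \<longleftrightarrow> (\<exists>k. lower_central_series c N k = {0})"

definition ideal_of :: "('n::finite) law \<Rightarrow> (complex^'n) set \<Rightarrow> (complex^'n) set \<Rightarrow> bool" where
  "ideal_of c L I \<longleftrightarrow> vec.subspace I \<and> I \<subseteq> L \<and> (\<forall>x\<in>L. \<forall>y\<in>I. bracket c x y \<in> I)"

definition is_nilradical :: "('n::finite) law \<Rightarrow> (complex^'n) set \<Rightarrow> bool" where
  "is_nilradical c N \<longleftrightarrow> ideal_of c UNIV N \<and> nilpotent c N \<and>
     (\<forall>I. ideal_of c UNIV I \<and> nilpotent c I \<longrightarrow> I \<subseteq> N)"

definition nonsplit :: "('n::finite) law \<Rightarrow> (complex^'n) set \<Rightarrow> bool" where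
  "nonsplit c N \<longleftrightarrow> \<not> (\<exists>I J. ideal_of c N I \<and> ideal_of c N J \<and> I \<noteq> {0} \<and> J \<noteq> {0} \<and>
     I \<inter> J = {0} \<and> {x + y | x y. x \<in> I \<and> y \<in> J} = N)"

section \<open>Characteristic sequence\<close>

definition is_basis :: "('i \<Rightarrow> complex^('n::finite)) \<Rightarrow> 'i set \<Rightarrow> (complex^'n) set \<Rightarrow> bool" where
  "is_basis b I S \<longleftrightarrow> inj_on b I \<and> vec.independent (b ` I) \<and> vec.span (b ` I) = S"

text \<open>\<open>jordan_sizes f N s\<close>: the restriction of \<open>f\<close> to \<open>N\<close> is nilpotent and \<open>s\<close> is the decreasing
  list of the sizes of its Jordan blocks. The block number \<open>i\<close> is spanned by the chain
  \<open>e i 0, e i 1, \<dots>, e i (s ! i - 1)\<close>.\<close>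

definition jordan_sizes ::
  "(complex^('n::finite) \<Rightarrow> complex^'n) \<Rightarrow> (complex^'n) set \<Rightarrow> nat list \<Rightarrow> bool" where
  "jordan_sizes f N s \<longleftrightarrow> sorted_wrt (\<ge>) s \<and> 0 \<notin> set s \<and>
     (\<exists>e. is_basis (\<lambda>(i, j). e i j) {(i, j). i < length s \<and> j < s ! i} N \<and>
       (\<forall>i < length s. \<forall>j < s ! i. f (e i j) = (if Suc j < s ! i then e i (Suc j) else 0)))"

definition characteristic_sequence :: "('n::finite) law \<Rightarrow> (complex^'n) set \<Rightarrow> nat list \<Rightarrow> bool" where
  "characteristic_sequence c N s \<longleftrightarrow>
     (\<exists>x \<in> N - lie_prod c N N. jordan_sizes (bracket c x) N s) \<and>
     (\<forall>x \<in> N - lie_prod c N N. \<forall>t. jordan_sizes (bracket c x) N t \<longrightarrow>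
        t = s \<or> (t, s) \<in> lexord {(a, b). a < b})"

section \<open>Invariants of the coadjoint representation\<close>

text \<open>A point \<open>z\<close> of the dual space is given by its values on the standard basis.\<close>

definition pairing :: "complex^('n::finite) \<Rightarrow> complex^'n \<Rightarrow> complex" where
  "pairing z x = (\<Sum>i\<in>UNIV. z $ i * x $ i)"

definition partial :: "(complex^('n::finite) \<Rightarrow> complex) \<Rightarrow> 'n \<Rightarrow> complex^'n \<Rightarrow> complex" where
  "partial F j z = deriv (\<lambda>t. F (z + t *s axis j 1)) 0"

definition complex_differentiable_at :: "(complex^('n::finite) \<Rightarrow> complex) \<Rightarrow> complex^'n \<Rightarrow> bool" where
  "complex_differentiable_at F z \<longleftrightarrow>
     (\<exists>D. (F has_derivative D) (at z) \<and> (\<forall>a h. D (a *s h) = a * D h))"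

definition coadjoint_operator ::
  "('n::finite) law \<Rightarrow> 'n \<Rightarrow> (complex^'n \<Rightarrow> complex) \<Rightarrow> complex^'n \<Rightarrow> complex" where
  "coadjoint_operator c i F z =
     - (\<Sum>j\<in>UNIV. \<Sum>k\<in>UNIV. c $ i $ j $ k * z $ k * partial F j z)"

definition coadjoint_invariant_on ::
  "('n::finite) law \<Rightarrow> (complex^'n) set \<Rightarrow> (complex^'n \<Rightarrow> complex) \<Rightarrow> bool" where
  "coadjoint_invariant_on c U F \<longleftrightarrow> open U \<and>
     (\<forall>z\<in>U. complex_differentiable_at F z \<and> (\<forall>i. coadjoint_operator c i F z = 0))"

text \<open>Generic points: those of some open dense set.\<close>

definition functionally_independent_on ::
  "(complex^('n::finite)) set \<Rightarrow> 'a set \<Rightarrow> ('a \<Rightarrow> complex^'n \<Rightarrow> complex) \<Rightarrow> bool" where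
  "functionally_independent_on U A F \<longleftrightarrow>
     (\<exists>W. W \<subseteq> U \<and> open W \<and> closure W = UNIV \<and>
       (\<forall>z\<in>W. \<forall>\<alpha>. (\<forall>j. (\<Sum>a\<in>A. \<alpha> a * partial (F a) j z) = 0) \<longrightarrow> (\<forall>a\<in>A. \<alpha> a = 0)))"

definition independent_invariants ::
  "('n::finite) law \<Rightarrow> (complex^'n) set \<Rightarrow> 'a set \<Rightarrow> ('a \<Rightarrow> complex^'n \<Rightarrow> complex) \<Rightarrow> bool" where
  "independent_invariants c U A F \<longleftrightarrow>
     (\<forall>a\<in>A. coadjoint_invariant_on c U (F a)) \<and> functionally_independent_on U A F"

section \<open>The three families of algebras\<close>

text \<open>A Lie algebra with distinguished basis is given by a finite set \<open>G\<close> of generators and a set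
  \<open>T\<close> of written brackets; \<open>(g, h, a, l) \<in> T\<close> stands for \<open>[g, h] = a l\<close>. An isomorphism from it to
  the law \<open>c\<close> is the same as a basis \<open>b\<close> (the image of the distinguished basis) with the same
  multiplication table.\<close>

datatype gen = X nat | Y nat | V nat

definition isomorphism_basis ::
  "gen set \<Rightarrow> (gen \<times> gen \<times> complex \<times> gen) set \<Rightarrow> ('n::finite) law \<Rightarrow> (gen \<Rightarrow> complex^'n) \<Rightarrow> bool" where
  "isomorphism_basis G T c b \<longleftrightarrow> is_basis b G UNIV \<and>
     (\<forall>(g, h, a, l) \<in> T. bracket c (b g) (b h) = a *s b l) \<and>
     (\<forall>g\<in>G. \<forall>h\<in>G. (\<nexists>a l. (g, h, a, l) \<in> T \<or> (h, g, a, l) \<in> T) \<longrightarrow> bracket c (b g) (b h) = 0)"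

definition gens_even :: "nat \<Rightarrow> gen set" where
  "gens_even m = X ` {0..3} \<union> Y ` {1..2 * m - 4} \<union> V ` {1..m}"

definition brackets_even :: "nat \<Rightarrow> (gen \<times> gen \<times> complex \<times> gen) set" where
  "brackets_even m =
     {(X 0, X i, 1, X (i + 1)) | i. i \<in> {1..2}} \<union>
     {(Y (2 * i - 1), Y (2 * i), 1, X 3) | i. i \<in> {1..m - 2}} \<union>
     {(V 1, X i, of_nat (i + 1), X i) | i. i \<in> {0..3}} \<union>
     {(V 1, Y (2 * i - 1), of_nat (i + 4), Y (2 * i - 1)) | i. i \<in> {1..m - 2}} \<union>
     {(V 1, Y (2 * i), - of_nat i, Y (2 * i)) | i. i \<in> {1..m - 2}} \<union>
     {(V 2, X i, 1, X i) | i. i \<in> {1..3}} \<union>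
     {(V 2, Y (2 * i), 1, Y (2 * i)) | i. i \<in> {1..m - 2}} \<union>
     {(V (i + 2), Y (2 * i - 1), 1, Y (2 * i - 1)) | i. i \<in> {1..m - 2}} \<union>
     {(V (i + 2), Y (2 * i), - 1, Y (2 * i)) | i. i \<in> {1..m - 2}}"

definition gens_odd :: "nat \<Rightarrow> gen set" where
  "gens_odd m = X ` {0..3} \<union> Y ` {1..2 * m - 3} \<union> V ` {1..m}"

definition brackets_odd :: "nat \<Rightarrow> (gen \<times> gen \<times> complex \<times> gen) set" where
  "brackets_odd m =
     {(X 0, X i, 1, X (i + 1)) | i. i \<in> {1..2}} \<union>
     {(X 1, Y (2 * m - 3), 1, X 3)} \<union>
     {(Y (2 * i - 1), Y (2 * i), 1, X 3) | i. i \<in> {1..m - 2}} \<union>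
     {(V 1, X i, of_nat (i + 1), X i) | i. i \<in> {0..3}} \<union>
     {(V 1, Y (2 * i - 1), of_nat (i + 4), Y (2 * i - 1)) | i. i \<in> {1..m - 2}} \<union>
     {(V 1, Y (2 * i), - of_nat i, Y (2 * i)) | i. i \<in> {1..m - 2}} \<union>
     {(V 1, Y (2 * m - 3), 2, Y (2 * m - 3))} \<union>
     {(V 2, X i, 1, X i) | i. i \<in> {1..3}} \<union>
     {(V 2, Y (2 * i), 1, Y (2 * i)) | i. i \<in> {1..m - 2}} \<union>
     {(V (i + 2), Y (2 * i - 1), 1, Y (2 * i - 1)) | i. i \<in> {1..m - 2}} \<union>
     {(V (i + 2), Y (2 * i), - 1, Y (2 * i)) | i. i \<in> {1..m - 2}}"

definition gens_five :: "gen set" where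
  "gens_five = X ` {0..3} \<union> {Y 1, V 1, V 2}"

definition brackets_five :: "(gen \<times> gen \<times> complex \<times> gen) set" where
  "brackets_five =
     {(X 0, X i, 1, X (i + 1)) | i. i \<in> {1..2}} \<union>
     {(X 1, X 2, 1, Y 1)} \<union>
     {(V 1, X i, of_nat (i + 1), X i) | i. i \<in> {0..3}} \<union>
     {(V 1, Y 1, 5, Y 1)} \<union>
     {(V 2, X i, 1, X i) | i. i \<in> {1..3}} \<union>
     {(V 2, Y 1, 2, Y 1)}"

text \<open>The published formula for the first invariant in the odd family is
  \<open>(x 0 * x 2 * x 3 + (x 2)\<^sup>2 * y (2*m-3) - 2 * (x 3)\<^sup>2 * v 2 + v 1 * (x 3)\<^sup>2
    - 2 * x 1 * x 3 * y (2*m-3)) / (- 2 * (x 3)\<^sup>2)\<close>.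
  That is not an invariant for the basis used here: the operator of \<open>X 3\<close> maps it to
  \<open>4 * x 3 * (- 1/2) + x 3 * 1 = - x 3\<close>. It is one when \<open>v 1\<close> is
  replaced by the coordinate of the toral element
  \<open>V 1 - 2 * V 2 - (\<Sum>j=1..m-2. (j + 4) * V (j + 2))\<close>, whose eigenvalues are \<open>0, 2\<close>
  on \<open>Y (2*i-1), Y (2*i)\<close> (\<open>1 \<le> i \<le> m-2\<close>), \<open>2\<close> on \<open>Y (2*m-3)\<close> and \<open>1, 0, 1, 2\<close> on \<open>X 0, X 1, X 2, X 3\<close>.\<close>

end

theory Submission
  imports Defs
begin

text \<open>
  Up to sign, the operator of \<open>Z\<close> applied to \<open>F\<close> at \<open>z\<close> is the differential of \<open>F\<close> at the vector
  \<open>coad c Z z\<close>, whose pairing with \<open>h\<close> is \<open>z [Z, h]\<close>. It is linear in \<open>Z\<close>, so invariance can be tested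
  on the distinguished basis, where it becomes an identity in the coordinates read off the
  multiplication table. Independence follows from the dual basis: for each invariant there is a
  direction along which its differential is nonzero while those of the others vanish, namely that of
  \<open>V (k + 2)\<close> (corrected by a multiple of \<open>V 1\<close> in the odd family) or of \<open>V 1\<close>,
  and that of \<open>X 0\<close> for the single invariant of the seven-dimensional algebra.
\<close>

section \<open>Complex derivatives and coadjoint vector fields\<close>

lemma pairing_add_left: "pairing (z + w) x = pairing z x + pairing w x"
  and pairing_scale_left: "pairing (a *s z) x = a * pairing z x"
  and pairing_add_right: "pairing z (x + y) = pairing z x + pairing z y"
  and pairing_diff_right: "pairing z (x - y) = pairing z x - pairing z y"
  and pairing_scale_right: "pairing z (a *s x) = a * pairing z x"
  and pairing_zero_right: "pairing z 0 = 0"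
  by (simp_all add: pairing_def algebra_simps sum.distrib sum_distrib_left sum_subtractf)

lemma pairing_sum_right: "pairing z (\<Sum>a\<in>A. f a) = (\<Sum>a\<in>A. pairing z (f a))"
  by (induction A rule: infinite_finite_induct) (simp_all add: pairing_zero_right pairing_add_right)

lemma bounded_linear_pairing: "bounded_linear (\<lambda>z. pairing z x)"
  unfolding pairing_def
  by (intro bounded_linear_sum bounded_linear_mult_const bounded_linear_vec_nth)

lemma has_derivative_pairing [derivative_intros]:
  "((\<lambda>z. pairing z x) has_derivative (\<lambda>h. pairing h x)) F"
  by (rule bounded_linear_imp_has_derivative[OF bounded_linear_pairing])

lemma continuous_on_pairing [continuous_intros]: "continuous_on S (\<lambda>z. pairing z x)"
  by (rule linear_continuous_on[OF bounded_linear_pairing])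

text \<open>The predicate \<open>complex_differentiable_at\<close> only asserts that some
  \<open>D\<close> exists; the computations below need \<open>D\<close> as an explicit
  formula.\<close>

definition has_complex_derivative ::
  "(complex^('n::finite) \<Rightarrow> complex) \<Rightarrow> (complex^'n \<Rightarrow> complex) \<Rightarrow> complex^'n \<Rightarrow> bool" where
  "has_complex_derivative F D z \<longleftrightarrow> (F has_derivative D) (at z) \<and> (\<forall>a h. D (a *s h) = a * D h)"

text \<open>By complex homogeneity, the differential along \<open>z + t *s axis j 1\<close> is
  multiplication by \<open>D (axis j 1)\<close>; this upgrades the real derivative in
  \<open>t\<close> to a complex one.\<close>

lemma partial_eq:
  assumes "has_complex_derivative F D z"
  shows "partial F j z = D (axis j 1)"
proof -
  have bl: "bounded_linear (\<lambda>t::complex. t *s (axis j 1 :: complex^'a::finite))"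
    by (auto intro!: linearI simp: linear_conv_bounded_linear[symmetric] vec_eq_iff algebra_simps)
  have "(F has_derivative D) (at (z + 0 *s axis j 1))"
    using assms by (simp add: has_complex_derivative_def)
  then have "((\<lambda>t. F (z + t *s axis j 1)) has_derivative (\<lambda>t. D (t *s axis j 1))) (at 0)"
    by (rule has_derivative_compose[rotated])
      (rule has_derivative_eq_rhs[OF has_derivative_add[OF has_derivative_const
          bounded_linear_imp_has_derivative[OF bl]]], simp)
  moreover have "(\<lambda>t. D (t *s axis j 1)) = (*) (D (axis j 1))"
    using assms by (auto simp: has_complex_derivative_def mult.commute)
  ultimately show ?thesis
    by (auto simp: partial_def has_field_derivative_def intro: DERIV_imp_deriv)
qed

lemma has_complex_derivative_linear:
  assumes "has_complex_derivative F D z"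
  shows "D (x + y) = D x + D y" "D (a *s x) = a * D x" "D 0 = 0"
    "D (\<Sum>i\<in>I. f i) = (\<Sum>i\<in>I. D (f i))"
proof -
  have "linear D"
    using assms has_derivative_linear by (auto simp: has_complex_derivative_def)
  then show "D (x + y) = D x + D y" "D 0 = 0" "D (\<Sum>i\<in>I. f i) = (\<Sum>i\<in>I. D (f i))"
    by (simp_all add: linear_add linear_0 linear_sum)
  show "D (a *s x) = a * D x"
    using assms by (simp add: has_complex_derivative_def)
qed

text \<open>Expand \<open>h\<close> in the standard basis. This is the bridge from sums of partial
  derivatives, in which invariance and independence are stated, to values of one
  differential.\<close>

lemma sum_partial:
  assumes "has_complex_derivative F D z"
  shows "(\<Sum>j\<in>UNIV. h $ j * partial F j z) = D h"
proof -
  have "D (\<Sum>j\<in>UNIV. h $ j *s axis j 1) = (\<Sum>j\<in>UNIV. h $ j * partial F j z)"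
    by (simp add: has_complex_derivative_linear[OF assms] partial_eq[OF assms])
  then show ?thesis by (simp add: basis_expansion)
qed

text \<open>The functional \<open>z\<close> composed with \<open>ad x\<close>, that is, minus the
  coadjoint action of \<open>x\<close> on \<open>z\<close>.\<close>

definition coad :: "('n::finite) law \<Rightarrow> complex^'n \<Rightarrow> complex^'n \<Rightarrow> complex^'n" where
  "coad c x z = (\<chi> j. \<Sum>i\<in>UNIV. \<Sum>k\<in>UNIV. x $ i * c $ i $ j $ k * z $ k)"

lemma pairing_coad: "pairing (coad c x z) y = pairing z (bracket c x y)"
proof -
  have "pairing (coad c x z) y = (\<Sum>j\<in>UNIV. \<Sum>i\<in>UNIV. \<Sum>k\<in>UNIV. x $ i * c $ i $ j $ k * z $ k * y $ j)"
    by (simp add: pairing_def coad_def sum_distrib_right)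
  also have "\<dots> = (\<Sum>i\<in>UNIV. \<Sum>j\<in>UNIV. \<Sum>k\<in>UNIV. x $ i * c $ i $ j $ k * z $ k * y $ j)"
    by (rule sum.swap)
  also have "\<dots> = (\<Sum>i\<in>UNIV. \<Sum>k\<in>UNIV. \<Sum>j\<in>UNIV. x $ i * c $ i $ j $ k * z $ k * y $ j)"
    by (rule sum.cong[OF refl], rule sum.swap)
  also have "\<dots> = (\<Sum>k\<in>UNIV. \<Sum>i\<in>UNIV. \<Sum>j\<in>UNIV. x $ i * c $ i $ j $ k * z $ k * y $ j)"
    by (rule sum.swap)
  also have "\<dots> = pairing z (bracket c x y)"
    by (simp add: pairing_def bracket_def sum_distrib_left mult_ac)
  finally show ?thesis .
qed

text \<open>The sum over \<open>k\<close> in the operator is the \<open>j\<close>-th component of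
  \<open>coad c (axis i 1) z\<close>, so \<open>sum_partial\<close> turns the whole into a
  directional derivative.\<close>

lemma coadjoint_operator_eq:
  assumes "has_complex_derivative F D z"
  shows "coadjoint_operator c i F z = - D (coad c (axis i 1) z)"
proof -
  have "coad c (axis i 1) z $ j = (\<Sum>k\<in>UNIV. c $ i $ j $ k * z $ k)" for j
  proof -
    have "coad c (axis i 1) z $ j =
        (\<Sum>i'\<in>UNIV. if i' = i then \<Sum>k\<in>UNIV. c $ i' $ j $ k * z $ k else 0)"
      unfolding coad_def vec_lambda_beta by (rule sum.cong) (auto simp: axis_def)
    then show ?thesis by simp
  qed
  then show ?thesis
    unfolding sum_partial[OF assms, symmetric]
    by (simp add: coadjoint_operator_def sum_distrib_right)
qed

text \<open>For fixed \<open>z\<close> the vectors \<open>x\<close> with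
  \<open>D (coad c x z) = 0\<close> form a subspace. It contains the distinguished basis, hence also
  the standard basis vectors that define the operators.\<close>

lemma coadjoint_invariant_onI:
  assumes basis: "is_basis b G UNIV" and "open U"
    and inv: "\<And>z. z \<in> U \<Longrightarrow>
      \<exists>D. has_complex_derivative F D z \<and> (\<forall>g\<in>G. D (coad c (b g) z) = 0)"
  shows "coadjoint_invariant_on c U F"
  unfolding coadjoint_invariant_on_def
proof (intro conjI ballI allI)
  fix z assume "z \<in> U"
  then obtain D where D: "has_complex_derivative F D z"
    and zero: "\<And>g. g \<in> G \<Longrightarrow> D (coad c (b g) z) = 0"
    using inv by blast
  then show "complex_differentiable_at F z"
    by (auto simp: complex_differentiable_at_def has_complex_derivative_def)
  have "coad c 0 z = 0"
    and "coad c (x + y) z = coad c x z + coad c y z"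
    and "coad c (a *s x) z = a *s coad c x z" for a x y
    by (simp_all add: coad_def vec_eq_iff algebra_simps sum.distrib sum_distrib_left)
  then have "vec.subspace {x. D (coad c x z) = 0}"
    by (auto simp: vec.subspace_def has_complex_derivative_linear[OF D])
  then have "vec.span (b ` G) \<subseteq> {x. D (coad c x z) = 0}"
    using zero by (intro vec.span_minimal) auto
  then have "D (coad c x z) = 0" for x
    using basis by (auto simp: is_basis_def)
  then show "coadjoint_operator c i F z = 0" for i
    by (simp add: coadjoint_operator_eq[OF D])
qed fact

section \<open>Dual functionals, functional independence and density\<close>

lemma is_basis_dual:
  fixes b :: "'i \<Rightarrow> complex^('n::finite)"
  assumes "is_basis b G UNIV"
  obtains h where "\<And>g. g \<in> G \<Longrightarrow> pairing h (b g) = f g"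
proof -
  have inj: "inj_on b G" and ind: "vec.independent (b ` G)"
    using assms by (auto simp: is_basis_def)
  \<comment> \<open>The linear extension is taken with values in a space \<open>complex^'a\<close>,
    so the scalar is stored in the one arbitrary coordinate \<open>undefined\<close> and read off
    there again.\<close>
  define f' where "f' v = (axis undefined (f (inv_into G b v)) :: complex^'a)" for v
  obtain \<phi> where lin: "Vector_Spaces.linear (*s) (*s) \<phi>" and \<phi>: "\<And>v. v \<in> b ` G \<Longrightarrow> \<phi> v = f' v"
    using vec.linear_independent_extend[OF ind, of f'] by blast
  define h :: "complex^'n" where "h = (\<chi> j. \<phi> (axis j 1) $ undefined)"
  have "pairing h x = \<phi> x $ undefined" for x
  proof -
    have "\<phi> x = \<phi> (\<Sum>j\<in>UNIV. x $ j *s axis j 1)" by (simp add: basis_expansion)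
    also have "\<dots> = (\<Sum>j\<in>UNIV. x $ j *s \<phi> (axis j 1))"
      using lin by (simp add: Vector_Spaces.linear_iff vec.linear_sum vec.linear_scale)
    finally show ?thesis by (simp add: pairing_def h_def mult.commute)
  qed
  then have "pairing h (b g) = f g" if "g \<in> G" for g
    using that inj by (simp add: \<phi> f'_def)
  then show ?thesis using that by blast
qed

text \<open>Pairing a linear relation between the gradients with \<open>h\<close> gives a relation
  between the numbers \<open>D a z h\<close>. A direction seen by one member only isolates the
  coefficient of that member.\<close>

lemma functionally_independent_onI:
  assumes "W \<subseteq> U" "open W" "closure W = UNIV" "finite A"
    and D: "\<And>z a. z \<in> W \<Longrightarrow> a \<in> A \<Longrightarrow> has_complex_derivative (F a) (D a z) z"
    and sep: "\<And>z a. z \<in> W \<Longrightarrow> a \<in> A \<Longrightarrow>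
      \<exists>h. D a z h \<noteq> 0 \<and> (\<forall>a'\<in>A - {a}. D a' z h = 0)"
  shows "functionally_independent_on U A F"
  unfolding functionally_independent_on_def
proof (intro exI[of _ W] conjI ballI allI impI)
  fix z \<alpha> a assume z: "z \<in> W" and a: "a \<in> A"
    and *: "\<forall>j. (\<Sum>a\<in>A. \<alpha> a * partial (F a) j z) = 0"
  obtain h where h: "D a z h \<noteq> 0" "\<And>a'. a' \<in> A - {a} \<Longrightarrow> D a' z h = 0"
    using sep[OF z a] by blast
  have "\<alpha> a * D a z h = (\<Sum>a\<in>A. \<alpha> a * D a z h)"
    using \<open>finite A\<close> a h(2) by (subst sum.remove[of _ a]) simp_all
  also have "\<dots> = (\<Sum>a\<in>A. \<Sum>j\<in>UNIV. \<alpha> a * (h $ j * partial (F a) j z))"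
    by (intro sum.cong refl) (simp add: sum_partial[OF D[OF z]] sum_distrib_left[symmetric])
  also have "\<dots> = (\<Sum>j\<in>UNIV. \<Sum>a\<in>A. \<alpha> a * (h $ j * partial (F a) j z))"
    by (rule sum.swap)
  also have "\<dots> = (\<Sum>j\<in>UNIV. h $ j * (\<Sum>a\<in>A. \<alpha> a * partial (F a) j z))"
    by (simp add: sum_distrib_left mult_ac)
  finally show "\<alpha> a = 0" using * h(1) by simp
qed (use assms in auto)

text \<open>On the complex line through \<open>z\<close> in direction \<open>h\<close> the
  parameters of nonvanishing have finite complement, hence are dense, and \<open>t = 0\<close> is in
  their closure. The continuous parametrization carries this to \<open>z\<close>.\<close>

lemma closure_nonzero_eq_UNIV:
  fixes f :: "complex^('n::finite) \<Rightarrow> complex"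
  assumes "\<And>z. finite {t. f (z + t *s h) = 0}"
  shows "closure {z. f z \<noteq> 0} = UNIV"
proof -
  have "z \<in> closure {z. f z \<noteq> 0}" for z
  proof -
    have "closure (- {t. f (z + t *s h) = 0}) = UNIV"
      using assms[of z] by (simp add: closure_complement empty_interior_finite)
    then have *: "(0::complex) \<in> closure {t. f (z + t *s h) \<noteq> 0}"
      by (simp add: Collect_neg_eq)
    have "continuous_on UNIV (\<lambda>t. z + t *s h)"
      by (intro continuous_on_add continuous_on_const linear_continuous_on)
        (auto intro!: linearI simp: linear_conv_bounded_linear[symmetric] vec_eq_iff algebra_simps)
    then have "(\<lambda>t. z + t *s h) ` closure {t. f (z + t *s h) \<noteq> 0} \<subseteq> closure {z. f z \<noteq> 0}"
      by (intro image_closure_subset) (auto intro: continuous_on_subset closure_subset[THEN subsetD])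
    then show ?thesis using * by force
  qed
  then show ?thesis by blast
qed

lemma closure_pairing_nonzero:
  assumes "is_basis b G UNIV" "g \<in> G"
  shows "closure {z. pairing z (b g) \<noteq> 0} = UNIV"
proof -
  \<comment> \<open>Along a functional that is 1 on all basis vectors, the coordinate of
    \<open>b g\<close> is \<open>t\<close> plus a constant and has a single zero.\<close>
  obtain h where h: "\<And>g. g \<in> G \<Longrightarrow> pairing h (b g) = 1"
    using is_basis_dual[OF assms(1), of "\<lambda>_. 1"] by blast
  have "{t. pairing (z + t *s h) (b g) = 0} \<subseteq> {- pairing z (b g)}" for z
    using assms(2) by (auto simp: pairing_add_left pairing_scale_left h add_eq_0_iff)
  then show ?thesis
    by (intro closure_nonzero_eq_UNIV[of _ h]) (auto intro: finite_subset)
qed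

lemma open_pairing_nonzero: "open {z. pairing z x \<noteq> 0}"
  by (intro open_Collect_neq continuous_intros)

lemma closure_Int_eq_UNIV:
  assumes "open A" "closure A = UNIV" "closure B = UNIV"
  shows "closure (A \<inter> B) = UNIV"
proof -
  have "A \<subseteq> closure (A \<inter> B)" using open_Int_closure_subset[OF assms(1), of B] assms(3) by simp
  then have "closure A \<subseteq> closure (A \<inter> B)" by (simp add: closure_minimal)
  then show ?thesis using assms(2) by blast
qed

text \<open>The multiplication table read in coordinates: a written bracket, a reversed one by
  antisymmetry, and one absent in both orders. Every entry computed later comes from these
  rules.\<close>

lemma pairing_bracket_isomorphism_basis:
  assumes "isomorphism_basis G T c b"
  shows "(g, h, a, l) \<in> T \<Longrightarrow> pairing z (bracket c (b g) (b h)) = a * pairing z (b l)"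
    and "\<lbrakk>c \<in> lie_laws; (h, g, a, l) \<in> T\<rbrakk> \<Longrightarrow> pairing z (bracket c (b g) (b h)) = - a * pairing z (b l)"
    and "\<lbrakk>g \<in> G; h \<in> G; \<And>a l. (g, h, a, l) \<notin> T; \<And>a l. (h, g, a, l) \<notin> T\<rbrakk> \<Longrightarrow>
      pairing z (bracket c (b g) (b h)) = 0"
proof -
  show *: "pairing z (bracket c (b g) (b h)) = a * pairing z (b l)" if "(g, h, a, l) \<in> T" for g h
    using assms that by (auto simp: isomorphism_basis_def pairing_scale_right)
  show "pairing z (bracket c (b g) (b h)) = 0"
    if "g \<in> G" "h \<in> G" "\<And>a l. (g, h, a, l) \<notin> T" "\<And>a l. (h, g, a, l) \<notin> T"
    using assms that by (auto simp: isomorphism_basis_def pairing_zero_right)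
  assume c: "c \<in> lie_laws" and T: "(h, g, a, l) \<in> T"
  have "bracket c x y = - bracket c y x" for x y
  proof -
    have anti: "c $ i $ j $ k = - c $ j $ i $ k" for i j k
      using c unfolding lie_laws_def by blast
    have "(\<Sum>i\<in>UNIV. \<Sum>j\<in>UNIV. x $ i * y $ j * c $ i $ j $ k)
        = - (\<Sum>i\<in>UNIV. \<Sum>j\<in>UNIV. y $ i * x $ j * c $ i $ j $ k)" for k
      by (subst sum.swap, subst anti) (simp add: sum_negf mult_ac)
    then show ?thesis by (simp add: bracket_def vec_eq_iff)
  qed
  then have "pairing z (bracket c (b g) (b h)) = - pairing z (bracket c (b h) (b g))"
    by (metis diff_0 pairing_diff_right pairing_zero_right)
  then show "pairing z (bracket c (b g) (b h)) = - a * pairing z (b l)"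
    using *[OF T] by simp
qed

section \<open>Multiplication tables and the even family\<close>

text \<open>The differential of \<open>y * y' / x + v\<close>, which is the fraction below after
  cancelling \<open>x\<close> in its second summand.\<close>

abbreviation pair_derivative where
  "pair_derivative x y y' v z h \<equiv>
    pairing h v + (pairing h y * pairing z y' + pairing z y * pairing h y') / pairing z x
      - pairing z y * pairing z y' * pairing h x / (pairing z x)\<^sup>2"

lemma has_complex_derivative_pair:
  assumes "pairing z x \<noteq> 0"
  shows "has_complex_derivative
    (\<lambda>z. (pairing z y * pairing z y' + pairing z x * pairing z v) / pairing z x)
    (\<lambda>h. pair_derivative x y y' v z h) z"
  unfolding has_complex_derivative_def
proof
  show "((\<lambda>z. (pairing z y * pairing z y' + pairing z x * pairing z v) / pairing z x) has_derivative
    (\<lambda>h. pair_derivative x y y' v z h)) (at z)"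
    using assms
    by (auto intro!: derivative_eq_intros simp: field_simps power2_eq_square)
qed (simp add: pairing_scale_left algebra_simps add_divide_distrib diff_divide_distrib)

text \<open>The exceptions are coarse necessary conditions for membership, kept identical to those
  for the odd table so that both families can be treated at once. The exception
  \<open>j = 2 * m - 3\<close> comes from the odd family.\<close>

lemma brackets_even_notin:
  shows "\<not> (i = 0 \<and> (j = 1 \<or> j = 2)) \<Longrightarrow> (X i, X j, a, l) \<notin> brackets_even m"
    and "\<not> (i = 1 \<and> j = 2 * m - 3) \<Longrightarrow> (X i, Y j, a, l) \<notin> brackets_even m"
    and "(X i, V j, a, l) \<notin> brackets_even m"
    and "(Y i, X j, a, l) \<notin> brackets_even m"
    and "\<not> (odd i \<and> j = i + 1) \<Longrightarrow> (Y i, Y j, a, l) \<notin> brackets_even m"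
    and "(Y i, V j, a, l) \<notin> brackets_even m"
    and "\<not> (i = 1 \<or> i = 2 \<and> j \<noteq> 0) \<Longrightarrow> (V i, X j, a, l) \<notin> brackets_even m"
    and "\<not> (i = 1 \<or> i = 2 \<and> even j \<or> i > 2 \<and> (j = 2 * (i - 2) - 1 \<or> j = 2 * (i - 2))) \<Longrightarrow>
      (V i, Y j, a, l) \<notin> brackets_even m"
    and "(V i, V j, a, l) \<notin> brackets_even m"
  unfolding brackets_even_def by auto

lemma brackets_odd_notin:
  shows "\<not> (i = 0 \<and> (j = 1 \<or> j = 2)) \<Longrightarrow> (X i, X j, a, l) \<notin> brackets_odd m"
    and "\<not> (i = 1 \<and> j = 2 * m - 3) \<Longrightarrow> (X i, Y j, a, l) \<notin> brackets_odd m"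
    and "(X i, V j, a, l) \<notin> brackets_odd m"
    and "(Y i, X j, a, l) \<notin> brackets_odd m"
    and "\<not> (odd i \<and> j = i + 1) \<Longrightarrow> (Y i, Y j, a, l) \<notin> brackets_odd m"
    and "(Y i, V j, a, l) \<notin> brackets_odd m"
    and "\<not> (i = 1 \<or> i = 2 \<and> j \<noteq> 0) \<Longrightarrow> (V i, X j, a, l) \<notin> brackets_odd m"
    and "\<not> (i = 1 \<or> i = 2 \<and> even j \<or> i > 2 \<and> (j = 2 * (i - 2) - 1 \<or> j = 2 * (i - 2))) \<Longrightarrow>
      (V i, Y j, a, l) \<notin> brackets_odd m"
    and "(V i, V j, a, l) \<notin> brackets_odd m"
  unfolding brackets_odd_def by auto

lemma brackets_notin:
  assumes "T = brackets_even m \<or> T = brackets_odd m"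
  shows "\<not> (i = 0 \<and> (j = 1 \<or> j = 2)) \<Longrightarrow> (X i, X j, a, l) \<notin> T"
    and "\<not> (i = 1 \<and> j = 2 * m - 3) \<Longrightarrow> (X i, Y j, a, l) \<notin> T"
    and "(X i, V j, a, l) \<notin> T"
    and "(Y i, X j, a, l) \<notin> T"
    and "\<not> (odd i \<and> j = i + 1) \<Longrightarrow> (Y i, Y j, a, l) \<notin> T"
    and "(Y i, V j, a, l) \<notin> T"
    and "\<not> (i = 1 \<or> i = 2 \<and> j \<noteq> 0) \<Longrightarrow> (V i, X j, a, l) \<notin> T"
    and "\<not> (i = 1 \<or> i = 2 \<and> even j \<or> i > 2 \<and> (j = 2 * (i - 2) - 1 \<or> j = 2 * (i - 2))) \<Longrightarrow>
      (V i, Y j, a, l) \<notin> T"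
    and "(V i, V j, a, l) \<notin> T"
  by (rule disjE[OF assms]; hypsubst; (rule brackets_even_notin brackets_odd_notin; assumption?))+

lemma brackets_even_mem:
  shows "(X 0, X 1, 1, X 2) \<in> brackets_even m"
    and "(X 0, X 2, 1, X 3) \<in> brackets_even m"
    and "i \<in> {0..3} \<Longrightarrow> (V 1, X i, of_nat (i + 1), X i) \<in> brackets_even m"
    and "i \<in> {1..3} \<Longrightarrow> (V 2, X i, 1, X i) \<in> brackets_even m"
    and "k \<in> {1..m - 2} \<Longrightarrow> (Y (2 * k - 1), Y (2 * k), 1, X 3) \<in> brackets_even m"
    and "k \<in> {1..m - 2} \<Longrightarrow> (V 1, Y (2 * k - 1), of_nat (k + 4), Y (2 * k - 1)) \<in> brackets_even m"
    and "k \<in> {1..m - 2} \<Longrightarrow> (V 1, Y (2 * k), - of_nat k, Y (2 * k)) \<in> brackets_even m"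
    and "k \<in> {1..m - 2} \<Longrightarrow> (V 2, Y (2 * k), 1, Y (2 * k)) \<in> brackets_even m"
    and "k \<in> {1..m - 2} \<Longrightarrow> (V (k + 2), Y (2 * k - 1), 1, Y (2 * k - 1)) \<in> brackets_even m"
    and "k \<in> {1..m - 2} \<Longrightarrow> (V (k + 2), Y (2 * k), - 1, Y (2 * k)) \<in> brackets_even m"
  unfolding brackets_even_def by ((simp; fail) | blast)+

lemma brackets_odd_mem:
  shows "(X 0, X 1, 1, X 2) \<in> brackets_odd m"
    and "(X 0, X 2, 1, X 3) \<in> brackets_odd m"
    and "i \<in> {0..3} \<Longrightarrow> (V 1, X i, of_nat (i + 1), X i) \<in> brackets_odd m"
    and "i \<in> {1..3} \<Longrightarrow> (V 2, X i, 1, X i) \<in> brackets_odd m"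
    and "k \<in> {1..m - 2} \<Longrightarrow> (Y (2 * k - 1), Y (2 * k), 1, X 3) \<in> brackets_odd m"
    and "k \<in> {1..m - 2} \<Longrightarrow> (V 1, Y (2 * k - 1), of_nat (k + 4), Y (2 * k - 1)) \<in> brackets_odd m"
    and "k \<in> {1..m - 2} \<Longrightarrow> (V 1, Y (2 * k), - of_nat k, Y (2 * k)) \<in> brackets_odd m"
    and "k \<in> {1..m - 2} \<Longrightarrow> (V 2, Y (2 * k), 1, Y (2 * k)) \<in> brackets_odd m"
    and "k \<in> {1..m - 2} \<Longrightarrow> (V (k + 2), Y (2 * k - 1), 1, Y (2 * k - 1)) \<in> brackets_odd m"
    and "k \<in> {1..m - 2} \<Longrightarrow> (V (k + 2), Y (2 * k), - 1, Y (2 * k)) \<in> brackets_odd m"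
  unfolding brackets_odd_def by ((simp; fail) | blast)+

lemma brackets_mem:
  assumes "T = brackets_even m \<or> T = brackets_odd m"
  shows "(X 0, X 1, 1, X 2) \<in> T"
    and "(X 0, X 2, 1, X 3) \<in> T"
    and "i \<in> {0..3} \<Longrightarrow> (V 1, X i, of_nat (i + 1), X i) \<in> T"
    and "i \<in> {1..3} \<Longrightarrow> (V 2, X i, 1, X i) \<in> T"
    and "k \<in> {1..m - 2} \<Longrightarrow> (Y (2 * k - 1), Y (2 * k), 1, X 3) \<in> T"
    and "k \<in> {1..m - 2} \<Longrightarrow> (V 1, Y (2 * k - 1), of_nat (k + 4), Y (2 * k - 1)) \<in> T"
    and "k \<in> {1..m - 2} \<Longrightarrow> (V 1, Y (2 * k), - of_nat k, Y (2 * k)) \<in> T"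
    and "k \<in> {1..m - 2} \<Longrightarrow> (V 2, Y (2 * k), 1, Y (2 * k)) \<in> T"
    and "k \<in> {1..m - 2} \<Longrightarrow> (V (k + 2), Y (2 * k - 1), 1, Y (2 * k - 1)) \<in> T"
    and "k \<in> {1..m - 2} \<Longrightarrow> (V (k + 2), Y (2 * k), - 1, Y (2 * k)) \<in> T"
  by (rule disjE[OF assms]; hypsubst; (rule brackets_even_mem brackets_odd_mem; assumption?))+

lemma brackets_odd_mem_last:
  "(X 1, Y (2 * m - 3), 1, X 3) \<in> brackets_odd m"
  "(V 1, Y (2 * m - 3), 2, Y (2 * m - 3)) \<in> brackets_odd m"
  by (simp_all add: brackets_odd_def)

lemma mem_gens_even [simp]:
  "X i \<in> gens_even m \<longleftrightarrow> i \<le> 3"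
  "Y i \<in> gens_even m \<longleftrightarrow> i \<in> {1..2 * m - 4}"
  "V i \<in> gens_even m \<longleftrightarrow> i \<in> {1..m}"
  by (auto simp: gens_even_def)

lemma mem_gens_odd [simp]:
  "X i \<in> gens_odd m \<longleftrightarrow> i \<le> 3"
  "Y i \<in> gens_odd m \<longleftrightarrow> i \<in> {1..2 * m - 3}"
  "V i \<in> gens_odd m \<longleftrightarrow> i \<in> {1..m}"
  by (auto simp: gens_odd_def)

text \<open>In both families \<open>X 3\<close> is central in the span of all \<open>X i\<close> and
  \<open>Y i\<close>; only \<open>V 1\<close> and \<open>V 2\<close> act on it, with weights 4 and
  1. Its coordinate is the source of all denominators there.\<close>

lemma pairing_bracket_X3:
  fixes c :: "('n::finite) law" and z :: "complex^'n"
  assumes iso: "isomorphism_basis G T c b" and c: "c \<in> lie_laws"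
    and GT: "(G, T) = (gens_even m, brackets_even m) \<or> (G, T) = (gens_odd m, brackets_odd m)"
    and g: "g \<in> G"
  shows "pairing z (bracket c (b g) (b (X 3))) =
    (if g = V 1 then 4 * pairing z (b (X 3)) else if g = V 2 then pairing z (b (X 3)) else 0)"
proof -
  have T: "T = brackets_even m \<or> T = brackets_odd m"
    using GT by blast
  note notin = brackets_notin[OF T]
  have G: "X 3 \<in> G" using GT by auto
  note X3 = brackets_mem(3,4)[OF T, of 3,
      THEN pairing_bracket_isomorphism_basis(1)[OF iso, of _ _ _ _ z], simplified]
  \<comment> \<open>Both orders of the pair must be absent from the table. Splitting on the
    constructor of \<open>g\<close> makes the exclusion rules applicable; what remains is arithmetic
    of indices.\<close>
  have "pairing z (bracket c (b g) (b (X 3))) = 0" if "g \<noteq> V 1" "g \<noteq> V 2"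
    by (rule pairing_bracket_isomorphism_basis(3)[OF iso g G]; insert that;
        cases g; simp; rule notin; auto; presburger)
  then show ?thesis using X3 by auto
qed

text \<open>\<open>Y (2 * k - 1)\<close>, \<open>Y (2 * k)\<close> and \<open>X 3\<close> span a
  Heisenberg algebra stable under the torus, and the weights on the pair add up to those on
  \<open>X 3\<close>: 4 for \<open>V 1\<close>, 1 for \<open>V 2\<close>, 0 for
  \<open>V (k + 2)\<close>. Besides the column of \<open>X 3\<close>, these three columns are all
  that the invariant of index \<open>k\<close> involves.\<close>

lemma
  fixes c :: "('n::finite) law" and z :: "complex^'n"
  assumes iso: "isomorphism_basis G T c b" and c: "c \<in> lie_laws"
    and GT: "(G, T) = (gens_even m, brackets_even m) \<or> (G, T) = (gens_odd m, brackets_odd m)"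
    and g: "g \<in> G" and k: "k \<in> {1..m - 2}"
  defines "B \<equiv> \<lambda>h. pairing z (bracket c (b g) (b h))" and "p \<equiv> \<lambda>h. pairing z (b h)"
  shows pairing_bracket_Y_odd:
      "B (Y (2 * k - 1)) = (if g = V 1 then of_nat (k + 4) * p (Y (2 * k - 1))
        else if g = V (k + 2) then p (Y (2 * k - 1)) else if g = Y (2 * k) then - p (X 3) else 0)"
    and pairing_bracket_Y_even:
      "B (Y (2 * k)) = (if g = V 1 then - of_nat k * p (Y (2 * k)) else if g = V 2 then p (Y (2 * k))
        else if g = V (k + 2) then - p (Y (2 * k)) else if g = Y (2 * k - 1) then p (X 3) else 0)"
    and pairing_bracket_V:
      "B (V (k + 2)) = (if g = Y (2 * k - 1) then - p (Y (2 * k - 1))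
        else if g = Y (2 * k) then p (Y (2 * k)) else 0)"
proof -
  note pos = pairing_bracket_isomorphism_basis(1)[OF iso, of _ _ _ _ z]
    and neg = pairing_bracket_isomorphism_basis(2)[OF iso c, of _ _ _ _ z]
    and zero = pairing_bracket_isomorphism_basis(3)[OF iso, of _ _ z]
  have T: "T = brackets_even m \<or> T = brackets_odd m"
    using GT by blast
  note notin = brackets_notin[OF T]
  have G: "Y (2 * k - 1) \<in> G" "Y (2 * k) \<in> G" "V (k + 2) \<in> G"
    using GT k by auto
  note mem = brackets_mem[OF T]
  note Y_odd = mem(6,9)[OF k, THEN pos] mem(9)[OF k, THEN neg]
    and Y_even = mem(7,8,10)[OF k, THEN pos] mem(10)[OF k, THEN neg]
  note YY = mem(5)[OF k, THEN pos] mem(5)[OF k, THEN neg]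
  have "pairing z (bracket c (b g) (b (Y (2 * k - 1)))) = 0" if "g \<noteq> V 1" "g \<noteq> V (k + 2)" "g \<noteq> Y (2 * k)"
    by (rule zero[OF g G(1)]; insert that k; cases g; simp; rule notin; auto; presburger)
  then show "B (Y (2 * k - 1)) = (if g = V 1 then of_nat (k + 4) * p (Y (2 * k - 1))
        else if g = V (k + 2) then p (Y (2 * k - 1)) else if g = Y (2 * k) then - p (X 3) else 0)"
    using Y_odd YY k unfolding B_def p_def by auto
  have "pairing z (bracket c (b g) (b (Y (2 * k)))) = 0"
    if "g \<noteq> V 1" "g \<noteq> V 2" "g \<noteq> V (k + 2)" "g \<noteq> Y (2 * k - 1)"
    by (rule zero[OF g G(2)]; insert that k; cases g; simp; rule notin; auto; presburger)
  then show "B (Y (2 * k)) = (if g = V 1 then - of_nat k * p (Y (2 * k)) else if g = V 2 then p (Y (2 * k))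
        else if g = V (k + 2) then - p (Y (2 * k)) else if g = Y (2 * k - 1) then p (X 3) else 0)"
    using Y_even YY k unfolding B_def p_def by auto
  have "pairing z (bracket c (b g) (b (V (k + 2)))) = 0" if "g \<noteq> Y (2 * k)" "g \<noteq> Y (2 * k - 1)"
    by (rule zero[OF g G(3)]; insert that k; cases g; simp; rule notin; auto; presburger)
  then show "B (V (k + 2)) = (if g = Y (2 * k - 1) then - p (Y (2 * k - 1))
        else if g = Y (2 * k) then p (Y (2 * k)) else 0)"
    using Y_even Y_odd k unfolding B_def p_def by auto
qed

text \<open>By the balance of weights each \<open>V i\<close> annihilates the quotient of the
  product of the two \<open>Y\<close> coordinates by that of \<open>X 3\<close>. The two
  \<open>Y\<close> vectors change this quotient by plus and minus their own coordinate, which the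
  change of the \<open>V (k + 2)\<close> coordinate cancels.\<close>

lemma coadjoint_invariant_pair:
  fixes c :: "('n::finite) law"
  assumes iso: "isomorphism_basis G T c b" and c: "c \<in> lie_laws"
    and GT: "(G, T) = (gens_even m, brackets_even m) \<or> (G, T) = (gens_odd m, brackets_odd m)"
    and k: "k \<in> {1..m - 2}"
  shows "coadjoint_invariant_on c {z. pairing z (b (X 3)) \<noteq> 0}
    (\<lambda>z. (pairing z (b (Y (2 * k - 1))) * pairing z (b (Y (2 * k)))
      + pairing z (b (X 3)) * pairing z (b (V (k + 2)))) / pairing z (b (X 3)))"
proof (rule coadjoint_invariant_onI[where b = b and G = G])
  show "is_basis b G UNIV"
    using iso by (simp add: isomorphism_basis_def)
  fix z assume "z \<in> {z. pairing z (b (X 3)) \<noteq> 0}"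
  then have z: "pairing z (b (X 3)) \<noteq> 0" by simp
  note D = has_complex_derivative_pair[OF z, of "b (Y (2 * k - 1))" "b (Y (2 * k))" "b (V (k + 2))"]
  show "\<exists>D. has_complex_derivative (\<lambda>z. (pairing z (b (Y (2 * k - 1))) * pairing z (b (Y (2 * k)))
      + pairing z (b (X 3)) * pairing z (b (V (k + 2)))) / pairing z (b (X 3))) D z \<and>
    (\<forall>g\<in>G. D (coad c (b g) z) = 0)"
  proof (intro exI conjI ballI, rule D)
    fix g assume g: "g \<in> G"
    \<comment> \<open>With truncated subtraction the two indices would coincide at
      \<open>k = 0\<close>; their difference keeps the cases of \<open>g\<close> apart.\<close>
    have "2 * k \<noteq> 2 * k - 1" using k by auto
    with z k show "pair_derivative (b (X 3)) (b (Y (2 * k - 1))) (b (Y (2 * k))) (b (V (k + 2))) z (coad c (b g) z) = 0"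
      unfolding pairing_coad pairing_bracket_X3[OF iso c GT g] pairing_bracket_Y_odd[OF iso c GT g k]
        pairing_bracket_Y_even[OF iso c GT g k] pairing_bracket_V[OF iso c GT g k]
      by (auto simp: field_simps power2_eq_square)
  qed
qed (rule open_pairing_nonzero)

section \<open>The even family: invariance and independence\<close>

lemma independent_invariants_even:
  fixes c :: "('n::finite) law"
  assumes iso: "isomorphism_basis (gens_even m) (brackets_even m) c b" and c: "c \<in> lie_laws"
  shows "independent_invariants c {z. pairing z (b (X 3)) \<noteq> 0} {1..m - 2}
    (\<lambda>k z. (pairing z (b (Y (2 * k - 1))) * pairing z (b (Y (2 * k)))
      + pairing z (b (X 3)) * pairing z (b (V (k + 2)))) / pairing z (b (X 3)))"
  unfolding independent_invariants_def
proof
  show "\<forall>k\<in>{1..m - 2}. coadjoint_invariant_on c {z. pairing z (b (X 3)) \<noteq> 0}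
    (\<lambda>z. (pairing z (b (Y (2 * k - 1))) * pairing z (b (Y (2 * k)))
      + pairing z (b (X 3)) * pairing z (b (V (k + 2)))) / pairing z (b (X 3)))"
    using coadjoint_invariant_pair[OF iso c] by blast
  have basis: "is_basis b (gens_even m) UNIV"
    using iso by (simp add: isomorphism_basis_def)
  let ?U = "{z. pairing z (b (X 3)) \<noteq> 0}"
  show "functionally_independent_on ?U {1..m - 2}
    (\<lambda>k z. (pairing z (b (Y (2 * k - 1))) * pairing z (b (Y (2 * k)))
      + pairing z (b (X 3)) * pairing z (b (V (k + 2)))) / pairing z (b (X 3)))"
  proof (rule functionally_independent_onI[where W = ?U])
    show "closure ?U = UNIV"
      by (rule closure_pairing_nonzero[OF basis]) simp
    fix z k assume k: "k \<in> {1..m - 2}"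
    \<comment> \<open>The functional dual to \<open>V (k + 2)\<close> vanishes on \<open>X 3\<close>
      and on all \<open>Y i\<close>, so each differential reduces to its \<open>V\<close> term, and
      only the one of index \<open>k\<close> survives.\<close>
    obtain h where h: "\<And>g. g \<in> gens_even m \<Longrightarrow> pairing h (b g) = (if g = V (k + 2) then 1 else 0)"
      using is_basis_dual[OF basis, of "\<lambda>g. if g = V (k + 2) then 1 else 0"] by blast
    have "pair_derivative (b (X 3)) (b (Y (2 * l - 1))) (b (Y (2 * l))) (b (V (l + 2))) z h
        = (if l = k then 1 else 0)" if "l \<in> {1..m - 2}" for l
    proof -
      have "{Y (2 * l - 1), Y (2 * l), X 3, V (l + 2)} \<subseteq> gens_even m"
        using that by auto
      then show ?thesis by (simp add: h)
    qed
    then show "\<exists>h. pair_derivative (b (X 3)) (b (Y (2 * k - 1))) (b (Y (2 * k))) (b (V (k + 2))) z h \<noteq> 0 \<and>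
      (\<forall>k\<in>{1..m - 2} - {k}. pair_derivative (b (X 3)) (b (Y (2 * k - 1))) (b (Y (2 * k))) (b (V (k + 2))) z h = 0)"
      using k by (intro exI[of _ h]) auto
  qed (auto intro: open_pairing_nonzero has_complex_derivative_pair)
qed

section \<open>The odd family\<close>

text \<open>The differential of \<open>- ((x0 * x2 - 2 * x1 * y) / x3 + x2^2 * y / x3^2 - 2 * v + w)
  / 2\<close>; the argument \<open>w\<close> will be the toral element.\<close>

abbreviation odd_derivative where
  "odd_derivative x0 x1 x2 x3 y v w z h \<equiv>
    - ((pairing h x0 * pairing z x2 + pairing z x0 * pairing h x2
          - 2 * pairing h x1 * pairing z y - 2 * pairing z x1 * pairing h y) / pairing z x3
        - (pairing z x0 * pairing z x2 - 2 * pairing z x1 * pairing z y) * pairing h x3 / (pairing z x3)\<^sup>2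
        + (2 * pairing z x2 * pairing h x2 * pairing z y + (pairing z x2)\<^sup>2 * pairing h y) / (pairing z x3)\<^sup>2
        - 2 * (pairing z x2)\<^sup>2 * pairing z y * pairing h x3 / pairing z x3 ^ 3
        - 2 * pairing h v + pairing h w) / 2"

lemma has_complex_derivative_odd:
  fixes x0 x1 x2 x3 y v w z :: "complex^('n::finite)"
  assumes nz: "pairing z x3 \<noteq> 0"
  shows "has_complex_derivative
    (\<lambda>z. (pairing z x0 * pairing z x2 * pairing z x3 + (pairing z x2)\<^sup>2 * pairing z y
        - 2 * (pairing z x3)\<^sup>2 * pairing z v + pairing z w * (pairing z x3)\<^sup>2
        - 2 * pairing z x1 * pairing z x3 * pairing z y) / (- 2 * (pairing z x3)\<^sup>2))
    (\<lambda>h. odd_derivative x0 x1 x2 x3 y v w z h) z"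
  unfolding has_complex_derivative_def
proof
  have eq: "(x0 * x2 * x3 + x2\<^sup>2 * y - 2 * x3\<^sup>2 * v + w * x3\<^sup>2 - 2 * x1 * x3 * y) / (- 2 * x3\<^sup>2)
      = - ((x0 * x2 - 2 * x1 * y) / x3 + x2\<^sup>2 * y / x3\<^sup>2 - 2 * v + w) / 2"
    if "x3 \<noteq> 0" for x0 x1 x2 x3 y v w :: complex
    using that by (simp add: field_simps power2_eq_square)
  have "((\<lambda>z. - ((pairing z x0 * pairing z x2 - 2 * pairing z x1 * pairing z y) / pairing z x3
        + (pairing z x2)\<^sup>2 * pairing z y / (pairing z x3)\<^sup>2 - 2 * pairing z v + pairing z w) / 2)
      has_derivative (\<lambda>h. odd_derivative x0 x1 x2 x3 y v w z h)) (at z)"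
  proof -
    have d1: "((\<lambda>z. (pairing z x0 * pairing z x2 - 2 * pairing z x1 * pairing z y) / pairing z x3)
      has_derivative (\<lambda>h. (pairing h x0 * pairing z x2 + pairing z x0 * pairing h x2
          - 2 * pairing h x1 * pairing z y - 2 * pairing z x1 * pairing h y) / pairing z x3
        - (pairing z x0 * pairing z x2 - 2 * pairing z x1 * pairing z y) * pairing h x3 / (pairing z x3)\<^sup>2)) (at z)"
      using nz by (auto intro!: derivative_eq_intros simp: field_simps power2_eq_square)
    have d2: "((\<lambda>z. (pairing z x2)\<^sup>2 * pairing z y / (pairing z x3)\<^sup>2)
      has_derivative (\<lambda>h. (2 * pairing z x2 * pairing h x2 * pairing z y + (pairing z x2)\<^sup>2 * pairing h y)
          / (pairing z x3)\<^sup>2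
        - 2 * (pairing z x2)\<^sup>2 * pairing z y * pairing h x3 / pairing z x3 ^ 3)) (at z)"
      using nz by (auto intro!: derivative_eq_intros simp: field_simps power2_eq_square power3_eq_cube)
    show ?thesis
      by (rule has_derivative_eq_rhs[OF bounded_linear.has_derivative[OF bounded_linear_divide
          has_derivative_minus[OF
          has_derivative_add[OF has_derivative_diff[OF has_derivative_add[OF d1 d2]
            has_derivative_mult_right[OF has_derivative_pairing]] has_derivative_pairing]]]])
        (simp add: algebra_simps)
  qed
  then show "((\<lambda>z. (pairing z x0 * pairing z x2 * pairing z x3 + (pairing z x2)\<^sup>2 * pairing z y
        - 2 * (pairing z x3)\<^sup>2 * pairing z v + pairing z w * (pairing z x3)\<^sup>2
        - 2 * pairing z x1 * pairing z x3 * pairing z y) / (- 2 * (pairing z x3)\<^sup>2))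
      has_derivative (\<lambda>h. odd_derivative x0 x1 x2 x3 y v w z h)) (at z)"
    \<comment> \<open>The simplified form agrees with the fraction only where the coordinate of
      \<open>x3\<close> is nonzero, so the derivative is transferred on that open set.\<close>
    by (rule has_derivative_transform_within_open[OF _ open_pairing_nonzero[of x3]])
      (use nz eq in auto)
qed (simp add: pairing_scale_left algebra_simps add_divide_distrib diff_divide_distrib)

text \<open>The columns of \<open>V 1\<close> and \<open>V 2\<close> are split by the kind of
  \<open>g\<close>, because their entries are negated weights that the toral computation consumes
  case by case. The bound on \<open>m\<close> puts \<open>Y (2 * m - 3)\<close> and
  \<open>V 2\<close> among the generators.\<close>

lemma
  fixes c :: "('n::finite) law" and z :: "complex^'n"
  assumes iso: "isomorphism_basis (gens_odd m) (brackets_odd m) c b" and c: "c \<in> lie_laws"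
    and g: "g \<in> gens_odd m" and m: "2 \<le> m"
  defines "B \<equiv> \<lambda>h. pairing z (bracket c (b g) (b h))" and "p \<equiv> \<lambda>h. pairing z (b h)"
  shows pairing_bracket_odd_X0:
      "B (X 0) = (if g = V 1 then p (X 0) else if g = X 1 then - p (X 2) else if g = X 2 then - p (X 3) else 0)"
    and pairing_bracket_odd_X1:
      "B (X 1) = (if g = X 0 then p (X 2) else if g = V 1 then 2 * p (X 1)
        else if g = V 2 then p (X 1) else if g = Y (2 * m - 3) then - p (X 3) else 0)"
    and pairing_bracket_odd_X2:
      "B (X 2) = (if g = X 0 then p (X 3) else if g = V 1 then 3 * p (X 2) else if g = V 2 then p (X 2) else 0)"
    and pairing_bracket_odd_Y_last:
      "B (Y (2 * m - 3)) = (if g = X 1 then p (X 3) else if g = V 1 then 2 * p (Y (2 * m - 3)) else 0)"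
    and pairing_bracket_odd_V1_X: "g = X i \<Longrightarrow> B (V 1) = - of_nat (i + 1) * p (X i)"
    and pairing_bracket_odd_V1_Y_odd:
      "\<lbrakk>k \<in> {1..m - 2}; g = Y (2 * k - 1)\<rbrakk> \<Longrightarrow> B (V 1) = - of_nat (k + 4) * p g"
    and pairing_bracket_odd_V1_Y_even:
      "\<lbrakk>k \<in> {1..m - 2}; g = Y (2 * k)\<rbrakk> \<Longrightarrow> B (V 1) = of_nat k * p g"
    and pairing_bracket_odd_V1_Y_last: "g = Y (2 * m - 3) \<Longrightarrow> B (V 1) = - 2 * p g"
    and pairing_bracket_odd_V2_X: "g = X i \<Longrightarrow> B (V 2) = (if i = 0 then 0 else - p (X i))"
    and pairing_bracket_odd_V2_Y_odd: "\<lbrakk>odd k; g = Y k\<rbrakk> \<Longrightarrow> B (V 2) = 0"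
    and pairing_bracket_odd_V2_Y_even:
      "\<lbrakk>k \<in> {1..m - 2}; g = Y (2 * k)\<rbrakk> \<Longrightarrow> B (V 2) = - p g"
    and pairing_bracket_odd_V_V: "\<lbrakk>g = V i; j \<in> {1..m}\<rbrakk> \<Longrightarrow> B (V j) = 0"
proof -
  note pos = pairing_bracket_isomorphism_basis(1)[OF iso, of _ _ _ _ z]
    and neg = pairing_bracket_isomorphism_basis(2)[OF iso c, of _ _ _ _ z]
    and zero = pairing_bracket_isomorphism_basis(3)[OF iso, of _ _ z]
  have G: "X 0 \<in> gens_odd m" "X 1 \<in> gens_odd m" "X 2 \<in> gens_odd m"
    "Y (2 * m - 3) \<in> gens_odd m" "V 2 \<in> gens_odd m"
    using m by auto
  note notin = brackets_odd_notin
  note mem = brackets_odd_mem(1,2) brackets_odd_mem(3,4)[of 1, simplified]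
    brackets_odd_mem(3,4)[of 2, simplified]
    brackets_odd_mem(3,4)[of 3, simplified] brackets_odd_mem(3)[of 0, simplified] brackets_odd_mem_last
  note brackets = mem[THEN pos] mem[THEN neg]
  have "pairing z (bracket c (b g) (b (X 0))) = 0" if "g \<noteq> V 1" "g \<noteq> X 1" "g \<noteq> X 2"
    by (rule zero[OF g G(1)]; insert that m; cases g; simp; rule notin; auto; presburger)
  then show "B (X 0) = (if g = V 1 then p (X 0)
        else if g = X 1 then - p (X 2)
        else if g = X 2 then - p (X 3)
        else 0)"
    using brackets m unfolding B_def p_def by auto
  have "pairing z (bracket c (b g) (b (X 1))) = 0" if "g \<noteq> X 0" "g \<noteq> V 1" "g \<noteq> V 2" "g \<noteq> Y (2 * m - 3)"
    by (rule zero[OF g G(2)]; insert that m; cases g; simp; rule notin; auto; presburger)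
  then show "B (X 1) = (if g = X 0 then p (X 2)
        else if g = V 1 then 2 * p (X 1)
        else if g = V 2 then p (X 1)
        else if g = Y (2 * m - 3) then - p (X 3)
        else 0)"
    using brackets m unfolding B_def p_def by auto
  have "pairing z (bracket c (b g) (b (X 2))) = 0" if "g \<noteq> X 0" "g \<noteq> V 1" "g \<noteq> V 2"
    by (rule zero[OF g G(3)]; insert that m; cases g; simp; rule notin; auto; presburger)
  then show "B (X 2) = (if g = X 0 then p (X 3)
        else if g = V 1 then 3 * p (X 2)
        else if g = V 2 then p (X 2)
        else 0)"
    using brackets m unfolding B_def p_def by auto
  have "pairing z (bracket c (b g) (b (Y (2 * m - 3)))) = 0" if "g \<noteq> X 1" "g \<noteq> V 1"
    by (rule zero[OF g G(4)]; insert that m g; cases g; simp; rule notin; auto; presburger)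
  then show "B (Y (2 * m - 3)) = (if g = X 1 then p (X 3)
        else if g = V 1 then 2 * p (Y (2 * m - 3))
        else 0)"
    using brackets m unfolding B_def p_def by auto
  have X_le: "i \<in> {0..3}" if "g = X i" for i
    using g that by simp
  show "B (V 1) = - of_nat (i + 1) * p (X i)" if "g = X i" for i
    using brackets_odd_mem(3)[OF X_le[OF that], THEN neg] that by (simp add: B_def p_def)
  show "B (V 1) = - of_nat (k + 4) * p g" if "k \<in> {1..m - 2}" "g = Y (2 * k - 1)" for k
    using brackets_odd_mem(6)[OF that(1), THEN neg] that by (simp add: B_def p_def)
  show "B (V 1) = of_nat k * p g" if "k \<in> {1..m - 2}" "g = Y (2 * k)" for k
    using brackets_odd_mem(7)[OF that(1), THEN neg] that by (simp add: B_def p_def)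
  show "B (V 1) = - 2 * p g" if "g = Y (2 * m - 3)"
    using brackets that by (simp add: B_def p_def)
  show "B (V 2) = (if i = 0 then 0 else - p (X i))" if "g = X i" for i
  \<comment> \<open>\<open>V 2\<close> does not act on \<open>X 0\<close>, so this entry rests on
    the absence of a bracket instead of a written one.\<close>
  proof (cases "i = 0")
    case True
    have "pairing z (bracket c (b g) (b (V 2))) = 0"
      by (rule zero[OF g G(5)]; insert that True; simp; rule notin; auto)
    then show ?thesis using True by (simp add: B_def)
  next
    case False
    then show ?thesis
      using brackets_odd_mem(4)[of i, THEN neg] X_le[OF that] that by (simp add: B_def p_def)
  qed
  show "B (V 2) = 0" if "odd k" "g = Y k" for k
    unfolding B_def by (rule zero[OF g G(5)]; insert that m; simp; rule notin; auto; presburger)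
  show "B (V 2) = - p g" if "k \<in> {1..m - 2}" "g = Y (2 * k)" for k
    using brackets_odd_mem(8)[OF that(1), THEN neg] that by (simp add: B_def p_def)
  show "B (V j) = 0" if "g = V i" "j \<in> {1..m}" for i j
    unfolding B_def by (rule zero[OF g]; insert that; simp add: notin)
qed

section \<open>The toral element of the odd family and the first invariant\<close>

definition toral :: "nat \<Rightarrow> (gen \<Rightarrow> complex^('n::finite)) \<Rightarrow> complex^'n" where
  "toral m b = b (V 1) - 2 *s b (V 2) - (\<Sum>j=1..m - 2. of_nat (j + 4) *s b (V (j + 2)))"

lemma pairing_toral:
  "pairing z (toral m b) = pairing z (b (V 1)) - 2 * pairing z (b (V 2))
    - (\<Sum>j=1..m - 2. of_nat (j + 4) * pairing z (b (V (j + 2))))"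
  unfolding toral_def pairing_diff_right pairing_scale_right pairing_sum_right ..

text \<open>The last \<open>Y\<close> is separated from the Heisenberg pairs: it brackets with
  \<open>X 1\<close> into \<open>X 3\<close> and has no partner among the
  \<open>Y i\<close>.\<close>

lemma gens_odd_cases:
  assumes "g \<in> gens_odd m" "2 \<le> m"
  obtains (X) i where "g = X i" "i \<le> 3"
  | (Y_last) "g = Y (2 * m - 3)"
  | (Y_odd) k where "k \<in> {1..m - 2}" "g = Y (2 * k - 1)"
  | (Y_even) k where "k \<in> {1..m - 2}" "g = Y (2 * k)"
  | (V) i where "g = V i"
proof (cases g)
  case (Y j)
  then have j: "1 \<le> j" "j \<le> 2 * m - 3" using assms by auto
  consider "j = 2 * m - 3" | "\<exists>k\<in>{1..m - 2}. j = 2 * k - 1" | "\<exists>k\<in>{1..m - 2}. j = 2 * k"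
  proof (cases "even j")
    case True
    then obtain k where "j = 2 * k" by (elim evenE)
    then have "k \<in> {1..m - 2}" using j by auto
    then show ?thesis using that(3) \<open>j = 2 * k\<close> by blast
  next
    case False
    then obtain k where k: "j = 2 * k + 1" by (elim oddE)
    show ?thesis
    proof (cases "j = 2 * m - 3")
      case False
      then have "k + 1 \<in> {1..m - 2}" "j = 2 * (k + 1) - 1" using j k by auto
      then show ?thesis using that(2) by blast
    qed (rule that(1))
  qed
  then show ?thesis using Y that by cases auto
qed (use assms that in auto)

text \<open>Up to the factor -1/2 this combination is the linear part of the first invariant; it is
  the coordinate of \<open>V 1 - 4 V 2\<close> minus the sum of the
  \<open>(j + 4) V (j + 2)\<close>. The 4 cancels the weight on \<open>X 3\<close>, and
  \<open>j + 4\<close> makes the weights on \<open>Y (2 * j - 1)\<close> and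
  \<open>Y (2 * j)\<close> vanish: \<open>(j + 4) - (j + 4)\<close> and
  \<open>- j - 4 + (j + 4)\<close>. The remaining weights 1, -2, -1 on \<open>X 0\<close>,
  \<open>X 1\<close>, \<open>X 2\<close> and 2 on the last \<open>Y\<close> appear negated, since
  the bracket has \<open>g\<close> in front.\<close>

lemma pairing_coad_toral:
  fixes c :: "('n::finite) law" and z :: "complex^'n"
  assumes iso: "isomorphism_basis (gens_odd m) (brackets_odd m) c b" and c: "c \<in> lie_laws"
    and g: "g \<in> gens_odd m" and m: "2 \<le> m"
  shows "pairing (coad c (b g) z) (toral m b) - 2 * pairing (coad c (b g) z) (b (V 2)) =
    (if g = X 0 then - pairing z (b (X 0)) else if g = X 1 then 2 * pairing z (b (X 1))
     else if g = X 2 then pairing z (b (X 2))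
     else if g = Y (2 * m - 3) then - 2 * pairing z (b (Y (2 * m - 3))) else 0)"
proof -
  let ?B = "\<lambda>h. pairing z (bracket c (b g) (b h))"
  have V: "?B (V (j + 2)) = (if g = Y (2 * j - 1) then - pairing z (b (Y (2 * j - 1)))
        else if g = Y (2 * j) then pairing z (b (Y (2 * j))) else 0)" if "j \<in> {1..m - 2}" for j
    using pairing_bracket_V[OF iso c _ g that] by simp
  have toral: "pairing (coad c (b g) z) (toral m b) - 2 * pairing (coad c (b g) z) (b (V 2)) =
      ?B (V 1) - 4 * ?B (V 2) - (\<Sum>j=1..m - 2. of_nat (j + 4) * ?B (V (j + 2)))"
    by (simp add: pairing_toral pairing_coad)
  note V1 = pairing_bracket_odd_V1_X[OF iso c g m] pairing_bracket_odd_V1_Y_odd[OF iso c g m]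
    pairing_bracket_odd_V1_Y_even[OF iso c g m] pairing_bracket_odd_V1_Y_last[OF iso c g m]
  note V2 = pairing_bracket_odd_V2_X[OF iso c g m] pairing_bracket_odd_V2_Y_odd[OF iso c g m]
    pairing_bracket_odd_V2_Y_even[OF iso c g m]
  show ?thesis
    using g m
  proof (cases rule: gens_odd_cases)
    case (X i)
    have "(\<Sum>j=1..m - 2. of_nat (j + 4) * ?B (V (j + 2))) = 0"
      by (intro sum.neutral ballI, subst V) (auto simp: X)
    moreover have "i = 0 \<or> i = 1 \<or> i = 2 \<or> i = 3" using X by linarith
    ultimately show ?thesis
      unfolding toral V1(1)[OF X(1)] V2(1)[OF X(1)] using X by auto
  next
    case Y_last
    have "(\<Sum>j=1..m - 2. of_nat (j + 4) * ?B (V (j + 2))) = 0"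
    proof (intro sum.neutral ballI)
      fix j assume j: "j \<in> {1..m - 2}"
      \<comment> \<open>As \<open>j\<close> is at most \<open>m - 2\<close>, the last
        \<open>Y\<close> belongs to no pair, so no \<open>V (j + 2)\<close> acts on it.\<close>
      then have "2 * m - 3 \<noteq> 2 * j - 1" "2 * m - 3 \<noteq> 2 * j" using m by (auto; presburger)+
      then show "of_nat (j + 4) * ?B (V (j + 2)) = 0" unfolding V[OF j] by (simp add: Y_last)
    qed
    moreover have "odd (2 * m - 3)" using m by presburger
    ultimately show ?thesis
      unfolding toral V1(4)[OF Y_last] using V2(2)[OF _ Y_last] Y_last by simp
  next
    case (Y_odd k)
    \<comment> \<open>Among \<open>V 3\<close>, ..., \<open>V m\<close> only
      \<open>V (k + 2)\<close> acts on the pair of index \<open>k\<close>, so one summand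
      remains.\<close>
    have "(\<Sum>j=1..m - 2. of_nat (j + 4) * ?B (V (j + 2)))
        = (\<Sum>j=1..m - 2. if j = k then - of_nat (k + 4) * pairing z (b g) else 0)"
    proof (rule sum.cong)
      fix j assume j: "j \<in> {1..m - 2}"
      then have "2 * k - 1 = 2 * j - 1 \<longleftrightarrow> j = k" "2 * k - 1 \<noteq> 2 * j"
        using Y_odd(1) by (auto; presburger)+
      then show "of_nat (j + 4) * ?B (V (j + 2)) = (if j = k then - of_nat (k + 4) * pairing z (b g) else 0)"
        unfolding V[OF j] by (simp add: Y_odd(2) algebra_simps)
    qed simp
    also have "\<dots> = - of_nat (k + 4) * pairing z (b g)" using Y_odd(1) by simp
    finally have sum: "(\<Sum>j=1..m - 2. of_nat (j + 4) * ?B (V (j + 2))) = - of_nat (k + 4) * pairing z (b g)" .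
    have "odd (2 * k - 1)" "2 * k - 1 \<noteq> 2 * m - 3" using Y_odd(1) m by (auto; presburger)+
    then show ?thesis
      unfolding toral sum V1(2)[OF Y_odd] V2(2)[OF \<open>odd (2 * k - 1)\<close> Y_odd(2)] by (simp add: Y_odd(2))
  next
    case (Y_even k)
    have "(\<Sum>j=1..m - 2. of_nat (j + 4) * ?B (V (j + 2)))
        = (\<Sum>j=1..m - 2. if j = k then of_nat (k + 4) * pairing z (b g) else 0)"
    proof (rule sum.cong)
      fix j assume j: "j \<in> {1..m - 2}"
      then have "2 * k \<noteq> 2 * j - 1" by (auto; presburger)
      then show "of_nat (j + 4) * ?B (V (j + 2)) = (if j = k then of_nat (k + 4) * pairing z (b g) else 0)"
        unfolding V[OF j] by (simp add: Y_even(2))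
    qed simp
    also have "\<dots> = of_nat (k + 4) * pairing z (b g)" using Y_even(1) by simp
    finally have sum: "(\<Sum>j=1..m - 2. of_nat (j + 4) * ?B (V (j + 2))) = of_nat (k + 4) * pairing z (b g)" .
    have "2 * k \<noteq> 2 * m - 3" using m by presburger
    then show ?thesis
      unfolding toral sum V1(3)[OF Y_even] V2(3)[OF Y_even] by (simp add: Y_even(2) algebra_simps)
  next
    case (V i)
    have zero: "?B (V j) = 0" if "j \<in> {1..m}" for j
      using pairing_bracket_odd_V_V[OF iso c g m V that] .
    then have "(\<Sum>j=1..m - 2. of_nat (j + 4) * ?B (V (j + 2))) = 0"
      using m by (intro sum.neutral ballI, subst zero) auto
    then show ?thesis
      unfolding toral using zero[of 1] zero[of 2] V m by simp
  qed
qed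

text \<open>The rational part \<open>(x0 * x2 - 2 * x1 * y) / x3 + x2^2 * y / x3^2\<close> has
  weight 0 under every \<open>V i\<close>. The vectors \<open>X 0\<close>, \<open>X 1\<close>,
  \<open>X 2\<close> and \<open>Y (2 * m - 3)\<close> change it by \<open>x0\<close>,
  \<open>- 2 * x1\<close>, \<open>- x2\<close> and \<open>2 * y\<close>, the negatives of the values
  in \<open>pairing_coad_toral\<close>.\<close>

lemma coadjoint_invariant_odd:
  fixes c :: "('n::finite) law"
  assumes iso: "isomorphism_basis (gens_odd m) (brackets_odd m) c b" and c: "c \<in> lie_laws"
    and m: "2 \<le> m"
  shows "coadjoint_invariant_on c {z. pairing z (b (X 3)) \<noteq> 0}
    (\<lambda>z. (pairing z (b (X 0)) * pairing z (b (X 2)) * pairing z (b (X 3))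
        + (pairing z (b (X 2)))\<^sup>2 * pairing z (b (Y (2 * m - 3)))
        - 2 * (pairing z (b (X 3)))\<^sup>2 * pairing z (b (V 2))
        + pairing z (toral m b) * (pairing z (b (X 3)))\<^sup>2
        - 2 * pairing z (b (X 1)) * pairing z (b (X 3)) * pairing z (b (Y (2 * m - 3))))
      / (- 2 * (pairing z (b (X 3)))\<^sup>2))" (is "coadjoint_invariant_on c ?U ?F")
proof (rule coadjoint_invariant_onI[where b = b and G = "gens_odd m"])
  show "is_basis b (gens_odd m) UNIV"
    using iso by (simp add: isomorphism_basis_def)
  fix z assume "z \<in> ?U"
  then have z: "pairing z (b (X 3)) \<noteq> 0" by simp
  show "\<exists>D. has_complex_derivative ?F D z \<and> (\<forall>g\<in>gens_odd m. D (coad c (b g) z) = 0)"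
  proof (intro exI conjI ballI, rule has_complex_derivative_odd[OF z])
    fix g assume g: "g \<in> gens_odd m"
    note table = pairing_bracket_odd_X0[OF iso c g m, of z, folded pairing_coad]
      pairing_bracket_odd_X1[OF iso c g m, of z, folded pairing_coad]
      pairing_bracket_odd_X2[OF iso c g m, of z, folded pairing_coad]
      pairing_bracket_X3[OF iso c _ g, of m z, simplified, folded pairing_coad]
      pairing_bracket_odd_Y_last[OF iso c g m, of z, folded pairing_coad]
    have t: "- 2 * pairing (coad c (b g) z) (b (V 2)) + pairing (coad c (b g) z) (toral m b) =
      (if g = X 0 then - pairing z (b (X 0)) else if g = X 1 then 2 * pairing z (b (X 1))
       else if g = X 2 then pairing z (b (X 2))
       else if g = Y (2 * m - 3) then - 2 * pairing z (b (Y (2 * m - 3))) else 0)"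
      using pairing_coad_toral[OF iso c g m, of z] by (simp add: algebra_simps)
    \<comment> \<open>A mere regrouping that brings the two torus terms together, so that
      \<open>t\<close> rewrites them as one.\<close>
    have D: "- (A - B + C' - E - 2 * pairing (coad c (b g) z) (b (V 2)) + pairing (coad c (b g) z) (toral m b)) / 2
      = - (A - B + C' - E + (- 2 * pairing (coad c (b g) z) (b (V 2)) + pairing (coad c (b g) z) (toral m b))) / 2"
      for A B C' E :: complex by (simp add: algebra_simps)
    show "odd_derivative (b (X 0)) (b (X 1)) (b (X 2)) (b (X 3)) (b (Y (2 * m - 3))) (b (V 2)) (toral m b)
        z (coad c (b g) z) = 0"
      unfolding D t unfolding table
      using z by (auto simp: field_simps power2_eq_square power3_eq_cube)
  qed
qed (rule open_pairing_nonzero)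

text \<open>Index 0 is reserved for the invariant with the toral term; the indices from 1 on are
  those of the Heisenberg pairs, of which there are none for \<open>m = 2\<close>.\<close>

lemma independent_invariants_odd:
  fixes c :: "('n::finite) law"
  assumes iso: "isomorphism_basis (gens_odd m) (brackets_odd m) c b" and c: "c \<in> lie_laws"
    and m: "2 \<le> m"
  shows "independent_invariants c {z. pairing z (b (X 3)) \<noteq> 0} {0..m - 2}
    (\<lambda>k z. if k = 0
      then (pairing z (b (X 0)) * pairing z (b (X 2)) * pairing z (b (X 3))
        + (pairing z (b (X 2)))\<^sup>2 * pairing z (b (Y (2 * m - 3)))
        - 2 * (pairing z (b (X 3)))\<^sup>2 * pairing z (b (V 2))
        + pairing z (toral m b) * (pairing z (b (X 3)))\<^sup>2
        - 2 * pairing z (b (X 1)) * pairing z (b (X 3)) * pairing z (b (Y (2 * m - 3))))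
      / (- 2 * (pairing z (b (X 3)))\<^sup>2)
      else (pairing z (b (Y (2 * k - 1))) * pairing z (b (Y (2 * k)))
      + pairing z (b (X 3)) * pairing z (b (V (k + 2)))) / pairing z (b (X 3)))"
    (is "independent_invariants c ?U _ ?F")
  unfolding independent_invariants_def
proof
  have GT: "(gens_odd m, brackets_odd m) = (gens_even m, brackets_even m) \<or>
      (gens_odd m, brackets_odd m) = (gens_odd m, brackets_odd m)" by simp
  show "\<forall>k\<in>{0..m - 2}. coadjoint_invariant_on c ?U (?F k)"
  proof
    fix k assume "k \<in> {0..m - 2}"
    then consider "k = 0" | "k \<in> {1..m - 2}" by force
    then show "coadjoint_invariant_on c ?U (?F k)"
    proof cases
      case 1
      then show ?thesis using coadjoint_invariant_odd[OF iso c m] by simp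
    next
      case 2
      then have "k \<noteq> 0" by simp
      show ?thesis
        unfolding if_not_P[OF \<open>k \<noteq> 0\<close>] by (rule coadjoint_invariant_pair[OF iso c GT 2])
    qed
  qed
  have basis: "is_basis b (gens_odd m) UNIV"
    using iso by (simp add: isomorphism_basis_def)
  let ?D = "\<lambda>k z h. if k = 0
    then odd_derivative (b (X 0)) (b (X 1)) (b (X 2)) (b (X 3)) (b (Y (2 * m - 3))) (b (V 2)) (toral m b) z h
    else pair_derivative (b (X 3)) (b (Y (2 * k - 1))) (b (Y (2 * k))) (b (V (k + 2))) z h"
  show "functionally_independent_on ?U {0..m - 2} ?F"
  proof (rule functionally_independent_onI[where W = ?U and D = ?D])
    show "closure ?U = UNIV"
      by (rule closure_pairing_nonzero[OF basis]) simp
    show "has_complex_derivative (?F k) (?D k z) z" if "z \<in> ?U" for z k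
      using that has_complex_derivative_odd has_complex_derivative_pair by (cases "k = 0") auto
    fix z k assume k: "k \<in> {0..m - 2}"
    \<comment> \<open>For \<open>k = 0\<close> this is dual to \<open>V 1\<close>. For
      \<open>k > 0\<close> it is dual to \<open>V (k + 2)\<close>, with the value
      \<open>k + 4\<close> added on \<open>V 1\<close> so that the toral coordinate, and with it the
      differential of index 0, vanishes along \<open>h\<close>.\<close>
    define f :: "gen \<Rightarrow> complex" where
      "f = (\<lambda>_. 0)(V 1 := if k = 0 then 1 else of_nat (k + 4), V (k + 2) := if k = 0 then 0 else 1)"
    obtain h where h: "\<And>g. g \<in> gens_odd m \<Longrightarrow> pairing h (b g) = f g"
      using is_basis_dual[OF basis, of f] by blast
    have "{X 0, X 1, X 2, X 3, Y (2 * m - 3), V 1, V 2} \<subseteq> gens_odd m"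
      using m by auto
    then have zero: "pairing h (b (X 0)) = 0" "pairing h (b (X 1)) = 0" "pairing h (b (X 2)) = 0"
        "pairing h (b (X 3)) = 0" "pairing h (b (Y (2 * m - 3))) = 0" "pairing h (b (V 2)) = 0"
      and V1: "pairing h (b (V 1)) = (if k = 0 then 1 else of_nat (k + 4))"
      by (simp_all add: h f_def)
    have pair: "pairing h (b (Y (2 * l - 1))) = 0" "pairing h (b (Y (2 * l))) = 0"
      "pairing h (b (V (l + 2))) = (if l = k then 1 else 0)" if "l \<in> {1..m - 2}" for l
    proof -
      have "{Y (2 * l - 1), Y (2 * l), V (l + 2)} \<subseteq> gens_odd m"
        using that by auto
      then show "pairing h (b (Y (2 * l - 1))) = 0" "pairing h (b (Y (2 * l))) = 0"
          "pairing h (b (V (l + 2))) = (if l = k then 1 else 0)"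
        using that by (simp_all add: h f_def)
    qed
    have "(\<Sum>j=1..m - 2. of_nat (j + 4) * pairing h (b (V (j + 2))))
        = (\<Sum>j=1..m - 2. if j = k then of_nat (k + 4) else 0 :: complex)"
      by (intro sum.cong refl, subst pair) auto
    also have "\<dots> = (if k = 0 then 0 else of_nat (k + 4))"
      using k by auto
    finally have toral: "pairing h (toral m b) = (if k = 0 then 1 else 0)"
      unfolding pairing_toral zero V1 by simp
    have "?D 0 z h = (if k = 0 then - (1 / 2) else 0)"
      unfolding zero toral by simp
    moreover have "?D l z h = (if l = k then 1 else 0)" if "l \<in> {1..m - 2}" for l
      unfolding zero pair[OF that] using that by simp
    ultimately have D: "?D l z h = (if l = k then if k = 0 then - (1 / 2) else 1 else 0)"
      if "l \<in> {0..m - 2}" for l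
      using that by (cases "l = 0") auto
    show "\<exists>h. ?D k z h \<noteq> 0 \<and> (\<forall>l\<in>{0..m - 2} - {k}. ?D l z h = 0)"
      by (intro exI[of _ h] conjI ballI; subst D) (use k in auto)
  qed (auto intro: open_pairing_nonzero)
qed

section \<open>The seven-dimensional algebra\<close>

abbreviation five_derivative where
  "five_derivative x0 x1 x2 x3 y z h \<equiv>
    3 * (2 * pairing z x0 * pairing z y + (pairing z x2)\<^sup>2 - 2 * pairing z x1 * pairing z x3)\<^sup>2
        * (2 * pairing h x0 * pairing z y + 2 * pairing z x0 * pairing h y
        + 2 * pairing z x2 * pairing h x2 - 2 * pairing h x1 * pairing z x3
        - 2 * pairing z x1 * pairing h x3) / (pairing z x3 * pairing z y)\<^sup>2
      - 2 * (2 * pairing z x0 * pairing z y + (pairing z x2)\<^sup>2 - 2 * pairing z x1 * pairing z x3) ^ 3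
        * (pairing h x3 * pairing z y + pairing z x3 * pairing h y)
        / (pairing z x3 * pairing z y) ^ 3"

text \<open>The quotient rule gives the denominator \<open>R^4\<close>; cancelling one
  \<open>R\<close> leaves two terms in which the logarithmic derivatives of \<open>Q\<close> and
  \<open>R\<close> can be compared.\<close>

lemma has_complex_derivative_cube_over_square:
  assumes Q: "has_complex_derivative Q Q' z" and R: "has_complex_derivative R R' z" and nz: "R z \<noteq> 0"
  shows "has_complex_derivative (\<lambda>z. Q z ^ 3 / (R z)\<^sup>2)
    (\<lambda>h. 3 * (Q z)\<^sup>2 * Q' h / (R z)\<^sup>2 - 2 * Q z ^ 3 * R' h / R z ^ 3) z"
proof -
  have "((\<lambda>z. Q z ^ 3 / (R z)\<^sup>2) has_derivative
    (\<lambda>h. 3 * (Q z)\<^sup>2 * Q' h / (R z)\<^sup>2 - 2 * Q z ^ 3 * R' h / R z ^ 3)) (at z)"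
  proof (rule has_derivative_eq_rhs)
    show "((\<lambda>z. Q z ^ 3 / (R z)\<^sup>2) has_derivative (\<lambda>h. ((of_nat 3 * Q' h * Q z ^ (3 - 1)) * (R z)\<^sup>2
      - Q z ^ 3 * (of_nat 2 * R' h * R z ^ (2 - 1))) / ((R z)\<^sup>2 * (R z)\<^sup>2))) (at z)"
      using Q R nz unfolding has_complex_derivative_def
      by (intro has_derivative_divide' has_derivative_power) auto
  qed (use nz in \<open>auto simp: fun_eq_iff field_simps power2_eq_square power3_eq_cube\<close>)
  then show ?thesis
    using Q R by (simp add: has_complex_derivative_def algebra_simps)
qed

lemma has_complex_derivative_five:
  fixes x0 x1 x2 x3 y z :: "complex^('n::finite)"
  assumes nz: "pairing z x3 \<noteq> 0" "pairing z y \<noteq> 0"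
  shows "has_complex_derivative
    (\<lambda>z. (2 * pairing z x0 * pairing z y + (pairing z x2)\<^sup>2 - 2 * pairing z x1 * pairing z x3) ^ 3
      / (pairing z x3 * pairing z y)\<^sup>2)
    (\<lambda>h. five_derivative x0 x1 x2 x3 y z h) z"
proof (rule has_complex_derivative_cube_over_square)
  show "has_complex_derivative
      (\<lambda>z. 2 * pairing z x0 * pairing z y + (pairing z x2)\<^sup>2 - 2 * pairing z x1 * pairing z x3)
      (\<lambda>h. 2 * pairing h x0 * pairing z y + 2 * pairing z x0 * pairing h y
        + 2 * pairing z x2 * pairing h x2 - 2 * pairing h x1 * pairing z x3
        - 2 * pairing z x1 * pairing h x3) z"
    unfolding has_complex_derivative_def
    by (auto intro!: derivative_eq_intros simp: pairing_scale_left algebra_simps)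
  show "has_complex_derivative (\<lambda>z. pairing z x3 * pairing z y)
      (\<lambda>h. pairing h x3 * pairing z y + pairing z x3 * pairing h y) z"
    unfolding has_complex_derivative_def
    by (auto intro!: derivative_eq_intros simp: pairing_scale_left algebra_simps)
qed (use nz in simp)

lemma gens_five_eq: "gens_five = {X 0, X 1, X 2, X 3, Y 1, V 1, V 2}"
proof -
  have "{0..3::nat} = {0, 1, 2, 3}" by auto
  then show ?thesis by (auto simp: gens_five_def)
qed

text \<open>Listed explicitly so that simplification can decide every pair of the seven
  generators.\<close>

lemma brackets_five_eq:
  "brackets_five = {(V 2, Y 1, 2, Y 1), (V 2, X 1, 1, X 1), (V 2, X 2, 1, X 2), (V 2, X 3, 1, X 3),
    (V 1, Y 1, 5, Y 1), (V 1, X 0, 1, X 0), (V 1, X 1, 2, X 1), (V 1, X 2, 3, X 2),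
    (V 1, X 3, 4, X 3), (X 1, X 2, 1, Y 1), (X 0, X 1, 1, X 2), (X 0, X 2, 1, X 3)}"
proof -
  have "{1..2} = {1, 2::nat}" "{0..3} = {0, 1, 2, 3::nat}" "{1..3} = {1, 2, 3::nat}"
    by auto
  then show ?thesis
    unfolding brackets_five_def Setcompr_eq_image by (simp add: numeral_eq_Suc)
qed

text \<open>\<open>Q = 2 * x0 * y1 + x2^2 - 2 * x1 * x3\<close> and \<open>R = x3 * y1\<close> are
  annihilated by all \<open>X i\<close> and \<open>Y 1\<close>, and are semi-invariants of
  \<open>V 1\<close>, \<open>V 2\<close> with weights 6, 2 and 9, 3. These are in the ratio 2 : 3,
  so \<open>Q^3 / R^2\<close> has weight 0.\<close>

lemma independent_invariants_five:
  fixes c :: "('n::finite) law"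
  assumes iso: "isomorphism_basis gens_five brackets_five c b" and c: "c \<in> lie_laws"
  shows "independent_invariants c {z. pairing z (b (X 3)) \<noteq> 0 \<and> pairing z (b (Y 1)) \<noteq> 0} {()}
    (\<lambda>_ z. (2 * pairing z (b (X 0)) * pairing z (b (Y 1)) + (pairing z (b (X 2)))\<^sup>2
      - 2 * pairing z (b (X 1)) * pairing z (b (X 3))) ^ 3 / (pairing z (b (X 3)) * pairing z (b (Y 1)))\<^sup>2)"
    (is "independent_invariants c ?U _ ?F")
proof -
  let ?P = "\<lambda>z. 2 * pairing z (b (X 0)) * pairing z (b (Y 1)) + (pairing z (b (X 2)))\<^sup>2
      - 2 * pairing z (b (X 1)) * pairing z (b (X 3))"
  have basis: "is_basis b gens_five UNIV"
    using iso by (simp add: isomorphism_basis_def)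
  have U: "?U = {z. pairing z (b (X 3)) \<noteq> 0} \<inter> {z. pairing z (b (Y 1)) \<noteq> 0}"
    by auto
  have "open ?U"
    unfolding U by (intro open_Int open_pairing_nonzero)
  have "closure ?U = UNIV"
    unfolding U by (intro closure_Int_eq_UNIV open_pairing_nonzero closure_pairing_nonzero[OF basis])
      (auto simp: gens_five_eq)
  show ?thesis
    unfolding independent_invariants_def
  proof
    show "\<forall>a\<in>{()}. coadjoint_invariant_on c ?U (?F a)"
    proof (intro ballI, rule coadjoint_invariant_onI[OF basis \<open>open ?U\<close>])
      fix z assume "z \<in> ?U"
      then have z: "pairing z (b (X 3)) \<noteq> 0" "pairing z (b (Y 1)) \<noteq> 0" by auto
      have "\<forall>(g, h, a, l)\<in>brackets_five. pairing z (bracket c (b g) (b h)) = a * pairing z (b l) \<and>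
          pairing z (bracket c (b h) (b g)) = - a * pairing z (b l)"
        using pairing_bracket_isomorphism_basis(1,2)[OF iso] c by blast
      note nonzero = this[unfolded brackets_five_eq, simplified]
      have "\<forall>g\<in>gens_five. \<forall>h\<in>gens_five. (g, h) \<notin> (\<lambda>(g, h, a, l). (g, h)) ` brackets_five \<longrightarrow>
          (h, g) \<notin> (\<lambda>(g, h, a, l). (g, h)) ` brackets_five \<longrightarrow>
          pairing z (bracket c (b g) (b h)) = 0"
        by (intro ballI impI pairing_bracket_isomorphism_basis(3)[OF iso]) force+
      note zero = this[unfolded brackets_five_eq gens_five_eq, simplified]
      show "\<exists>D. has_complex_derivative (?F ()) D z \<and> (\<forall>g\<in>gens_five. D (coad c (b g) z) = 0)"
      proof (intro exI conjI, rule has_complex_derivative_five[OF z])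
        \<comment> \<open>Here \<open>s\<close> and \<open>t\<close> are the weights of
          \<open>Q\<close> and \<open>R\<close>, and the cube over the square has weight
          \<open>3 * s - 2 * t\<close>.\<close>
        have homogeneous: "3 * P\<^sup>2 * (s * P) / R\<^sup>2 - 2 * P ^ 3 * (t * R) / R ^ 3 = 0"
          if "3 * s = 2 * t" "R \<noteq> 0" for P R s t :: complex
        proof -
          have "3 * P\<^sup>2 * (s * P) / R\<^sup>2 - 2 * P ^ 3 * (t * R) / R ^ 3 = (3 * s - 2 * t) * P ^ 3 / R\<^sup>2"
            using \<open>R \<noteq> 0\<close> by (simp add: field_simps power2_eq_square power3_eq_cube)
          then show ?thesis using that by simp
        qed
        have "2 * pairing (coad c (b g) z) (b (X 0)) * pairing z (b (Y 1))
            + 2 * pairing z (b (X 0)) * pairing (coad c (b g) z) (b (Y 1))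
            + 2 * pairing z (b (X 2)) * pairing (coad c (b g) z) (b (X 2))
            - 2 * pairing (coad c (b g) z) (b (X 1)) * pairing z (b (X 3))
            - 2 * pairing z (b (X 1)) * pairing (coad c (b g) z) (b (X 3))
          = (if g = V 1 then 6 else if g = V 2 then 2 else 0) * ?P z \<and>
            pairing (coad c (b g) z) (b (X 3)) * pairing z (b (Y 1))
            + pairing z (b (X 3)) * pairing (coad c (b g) z) (b (Y 1))
          = (if g = V 1 then 9 else if g = V 2 then 3 else 0) * (pairing z (b (X 3)) * pairing z (b (Y 1)))"
          if "g \<in> gens_five" for g
          using that unfolding gens_five_eq
          by (elim insertE emptyE; simp add: pairing_coad nonzero zero power2_eq_square algebra_simps)
        note weights = this[THEN conjunct1] this[THEN conjunct2]
        show "\<forall>g\<in>gens_five. five_derivative (b (X 0)) (b (X 1)) (b (X 2)) (b (X 3)) (b (Y 1)) z (coad c (b g) z) = 0"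
        proof
          fix g assume "g \<in> gens_five"
          note weights = weights[OF this]
          show "five_derivative (b (X 0)) (b (X 1)) (b (X 2)) (b (X 3)) (b (Y 1)) z (coad c (b g) z) = 0"
            unfolding weights by (rule homogeneous) (use z in auto)
        qed
      qed
    qed
    \<comment> \<open>The zeros of \<open>Q\<close> are left out because the differential of
      \<open>Q^3 / R^2\<close> vanishes on them.\<close>
    let ?W = "?U \<inter> {z. ?P z \<noteq> 0}"
    show "functionally_independent_on ?U {()} ?F"
    proof (rule functionally_independent_onI[where W = ?W])
      show "open ?W"
        by (intro open_Int \<open>open ?U\<close> open_Collect_neq continuous_intros)
      \<comment> \<open>The dual of \<open>X 2\<close> is used because \<open>Q\<close> contains the
        square of that coordinate: along it \<open>Q\<close> is a monic quadratic in
        \<open>t\<close> at every \<open>z\<close>, so it has finitely many zeros.\<close>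
      obtain h where h: "\<And>g. g \<in> gens_five \<Longrightarrow> pairing h (b g) = (if g = X 2 then 1 else 0)"
        using is_basis_dual[OF basis, of "\<lambda>g. if g = X 2 then 1 else 0"] by blast
      have "closure {z. ?P z \<noteq> 0} = UNIV"
      proof (rule closure_nonzero_eq_UNIV[where h = h])
        fix z
        have "{t. ?P (z + t *s h) = 0} = {t. poly [:?P z, 2 * pairing z (b (X 2)), 1:] t = 0}"
          by (auto simp: pairing_add_left pairing_scale_left h gens_five_eq power2_eq_square algebra_simps)
        then show "finite {t. ?P (z + t *s h) = 0}"
          by (simp add: poly_roots_finite del: poly_pCons)
      qed
      then show "closure ?W = UNIV"
        by (intro closure_Int_eq_UNIV \<open>open ?U\<close> \<open>closure ?U = UNIV\<close>)
      fix z and a :: unit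
      assume z: "z \<in> ?W"
      \<comment> \<open>In the direction dual to \<open>X 0\<close> the factor \<open>R\<close> is
        constant and \<open>Q\<close> has derivative \<open>2 * y1\<close>, so the differential is
        \<open>6 * Q^2 * y1 / R^2\<close>, which is nonzero on \<open>?W\<close>.\<close>
      obtain h where h: "\<And>g. g \<in> gens_five \<Longrightarrow> pairing h (b g) = (if g = X 0 then 1 else 0)"
        using is_basis_dual[OF basis, of "\<lambda>g. if g = X 0 then 1 else 0"] by blast
      have "five_derivative (b (X 0)) (b (X 1)) (b (X 2)) (b (X 3)) (b (Y 1)) z h \<noteq> 0"
        using z by (simp add: h gens_five_eq)
      then show "\<exists>h. five_derivative (b (X 0)) (b (X 1)) (b (X 2)) (b (X 3)) (b (Y 1)) z h \<noteq> 0 \<and>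
          (\<forall>a'\<in>{()} - {a}. five_derivative (b (X 0)) (b (X 1)) (b (X 2)) (b (X 3)) (b (Y 1)) z h = 0)"
        by auto
    qed (auto intro: has_complex_derivative_five)
  qed
qed

section \<open>The three families together\<close>

theorem theorem4:
  fixes c :: "('n::finite) law" and N :: "(complex^'n) set" and r :: nat
  assumes "c \<in> lie_laws"
    and "solvable c"
    and "rigid c"
    and "is_nilradical c N"
    and "nonsplit c N"
    and "characteristic_sequence c N (3 # replicate r 1)"
  shows
    "(\<forall>m b. 3 \<le> m \<and> isomorphism_basis (gens_even m) (brackets_even m) c b \<longrightarrow>
       independent_invariants c {z. pairing z (b (X 3)) \<noteq> 0} {1..m - 2}
         (\<lambda>k z. let x = (\<lambda>i. pairing z (b (X i)));
                   y = (\<lambda>i. pairing z (b (Y i)));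
                   v = (\<lambda>i. pairing z (b (V i)))
               in (y (2 * k - 1) * y (2 * k) + x 3 * v (k + 2)) / x 3)) \<and>
     (\<forall>m b. 2 \<le> m \<and> isomorphism_basis (gens_odd m) (brackets_odd m) c b \<longrightarrow>
       independent_invariants c {z. pairing z (b (X 3)) \<noteq> 0} {0..m - 2}
         (\<lambda>k z. let x = (\<lambda>i. pairing z (b (X i)));
                   y = (\<lambda>i. pairing z (b (Y i)));
                   v = (\<lambda>i. pairing z (b (V i)))
               in if k = 0
                  then (x 0 * x 2 * x 3 + (x 2)\<^sup>2 * y (2 * m - 3) - 2 * (x 3)\<^sup>2 * v 2
                         + (v 1 - 2 * v 2 - (\<Sum>j=1..m - 2. of_nat (j + 4) * v (j + 2))) * (x 3)\<^sup>2
                         - 2 * x 1 * x 3 * y (2 * m - 3))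
                       / (- 2 * (x 3)\<^sup>2)
                  else (x 3 * v (k + 2) + y (2 * k - 1) * y (2 * k)) / x 3)) \<and>
     (\<forall>b. isomorphism_basis gens_five brackets_five c b \<longrightarrow>
       independent_invariants c
         {z. pairing z (b (X 3)) \<noteq> 0 \<and> pairing z (b (Y 1)) \<noteq> 0} {()}
         (\<lambda>_ z. let x = (\<lambda>i. pairing z (b (X i)));
                   y = (\<lambda>i. pairing z (b (Y i)))
               in (2 * x 0 * y 1 + (x 2)\<^sup>2 - 2 * x 1 * x 3) ^ 3 / (x 3 * y 1)\<^sup>2))"
proof (intro conjI allI impI; (elim conjE)?)
  fix m b assume "3 \<le> m" and iso: "isomorphism_basis (gens_even m) (brackets_even m) c b"
  show "independent_invariants c {z. pairing z (b (X 3)) \<noteq> 0} {1..m - 2}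
         (\<lambda>k z. let x = (\<lambda>i. pairing z (b (X i)));
                   y = (\<lambda>i. pairing z (b (Y i)));
                   v = (\<lambda>i. pairing z (b (V i)))
               in (y (2 * k - 1) * y (2 * k) + x 3 * v (k + 2)) / x 3)"
    using independent_invariants_even[OF iso assms(1)] unfolding Let_def .
next
  fix m b assume m: "2 \<le> m" and iso: "isomorphism_basis (gens_odd m) (brackets_odd m) c b"
  show "independent_invariants c {z. pairing z (b (X 3)) \<noteq> 0} {0..m - 2}
         (\<lambda>k z. let x = (\<lambda>i. pairing z (b (X i)));
                   y = (\<lambda>i. pairing z (b (Y i)));
                   v = (\<lambda>i. pairing z (b (V i)))
               in if k = 0
                  then (x 0 * x 2 * x 3 + (x 2)\<^sup>2 * y (2 * m - 3) - 2 * (x 3)\<^sup>2 * v 2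
                         + (v 1 - 2 * v 2 - (\<Sum>j=1..m - 2. of_nat (j + 4) * v (j + 2))) * (x 3)\<^sup>2
                         - 2 * x 1 * x 3 * y (2 * m - 3))
                       / (- 2 * (x 3)\<^sup>2)
                  else (x 3 * v (k + 2) + y (2 * k - 1) * y (2 * k)) / x 3)"
    \<comment> \<open>Expanding the toral coordinate gives the \<open>V\<close> coordinates of the
      statement; commutativity reorders the numerator of the pair invariants.\<close>
    using independent_invariants_odd[OF iso assms(1) m]
    unfolding Let_def pairing_toral add.commute[of "pairing _ (b (X 3)) * _"] .
next
  fix b assume iso: "isomorphism_basis gens_five brackets_five c b"
  show "independent_invariants c
         {z. pairing z (b (X 3)) \<noteq> 0 \<and> pairing z (b (Y 1)) \<noteq> 0} {()}
         (\<lambda>_ z. let x = (\<lambda>i. pairing z (b (X i)));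
                   y = (\<lambda>i. pairing z (b (Y i)))
               in (2 * x 0 * y 1 + (x 2)\<^sup>2 - 2 * x 1 * x 3) ^ 3 / (x 3 * y 1)\<^sup>2)"
    using independent_invariants_five[OF iso assms(1)] unfolding Let_def .
qed

end
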